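(* Let $\mathcal{H}\in\mathbb{C}^{[n_1,\ldots,n_m]}$ be $\mathbb{C}$-positive definite. Then there exist integers $k_1,\ldots,k_m\ge 0$ such that $\mathcal{H}\in\Omega_{\mathbb{C}}^{k_1\ldots k_m}$. Consequently, $$\operatorname{int}\big(\mathscr{P}_{\mathbb{C}}^{[n_1,\ldots,n_m]}\big)\subseteq\bigcup_{k_1,\ldots,k_m\ge 0}\Omega_{\mathbb{C}}^{k_1\ldots k_m}\subseteq\mathscr{P}_{\mathbb{C}}^{[n_1,\ldots,n_m]}.$$
   Context: $\mathbb{C}^{[n_1,\ldots,n_m]}$ is the real vector space of tensors $\mathcal{H}\in\mathbb{C}^{n_1\times\cdots\times n_m\times n_1\times\cdots\times n_m}$ with $\mathcal{H}_{i_1\ldots i_m j_1\ldots j_m}=\overline{\mathcal{H}_{j_1\ldots j_m i_1\ldots i_m}}$. For $x=(x_1,\ldots,x_m)$, $x_i\in\mathbb{C}^{n_i}$, let $\mathcal{H}(x,\overline{x}):=\sum\mathcal{H}_{i_1\ldots i_mj_1\ldots j_m}\overline{(x_1)_{i_1}\cdots(x_m)_{i_m}}(x_1)_{j_1}\cdots(x_m)_{j_m}$ (the inner product of $\mathcal{H}$ with $x_1\otimes\cdots\otimes x_m\otimes\overline{x_1}\otimes\cdots\otimes\overline{x_m}$, where $\langle\mathcal{A},\mathcal{B}\rangle=\sum\mathcal{A}_{\cdot}\overline{\mathcal{B}_{\cdot}}$), a real-valued conjugate polynomial. $\mathcal{H}$ is $\mathbb{C}$-psd if $\mathcal{H}(x,\overline{x})\ge0$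 for all $x_i\in\mathbb{C}^{n_i}$, and $\mathbb{C}$-positive definite if $\mathcal{H}(x,\overline{x})>0$ for all nonzero $x_i\in\mathbb{C}^{n_i}$. $\mathscr{P}_{\mathbb{C}}^{[n_1,\ldots,n_m]}$ is the cone of $\mathbb{C}$-psd tensors. $\Sigma[x]$ denotes the set of Hermitian sums of squares, i.e. conjugate polynomials of the form $|p_1(x)|^2+\cdots+|p_k(x)|^2$ with $p_i$ complex polynomials in $x$ (not involving $\overline{x}$). With $|x_i|:=\sqrt{x_i^*x_i}$, $\Omega_{\mathbb{C}}^{k_1\ldots k_m}:=\{\mathcal{H}\in\mathbb{C}^{[n_1,\ldots,n_m]}:|x_1|^{2k_1}\cdots|x_m|^{2k_m}\mathcal{H}(x,\overline{x})\in\Sigma[x]\}$. $\operatorname{int}$ denotes interior in the Euclidean topology. *)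

theory Defs
  imports "HOL-Analysis.Analysis"
begin

text \<open>Dimensions: m modes, mode i has dimension n i (for i < m).
  A point x = (x_1,...,x_m) is x :: nat \<Rightarrow> nat \<Rightarrow> complex, with x i j the
  j-th coordinate of x_i (i < m, j < n i); other values are ignored.
  A multi-index (i_1,...,i_m) is a function in PiE {..<m} (\<lambda>i. {..<n i}).
  A tensor H is a function of two multi-indices; only values on the
  multi-index set matter.\<close>

definition midx :: "nat \<Rightarrow> (nat \<Rightarrow> nat) \<Rightarrow> (nat \<Rightarrow> nat) set" where
  "midx m n = PiE {..<m} (\<lambda>i. {..<n i})"

type_synonym ctensor = "(nat \<Rightarrow> nat) \<Rightarrow> (nat \<Rightarrow> nat) \<Rightarrow> complex"

definition herm_tensor :: "nat \<Rightarrow> (nat \<Rightarrow> nat) \<Rightarrow> ctensor \<Rightarrow> bool" where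
  "herm_tensor m n H \<longleftrightarrow> (\<forall>I\<in>midx m n. \<forall>J\<in>midx m n. H I J = cnj (H J I))"

text \<open>H(x, conj x) = sum H_{IJ} conj(x_I) x_J  (real-valued for Hermitian H).\<close>
definition hform :: "nat \<Rightarrow> (nat \<Rightarrow> nat) \<Rightarrow> ctensor \<Rightarrow> (nat \<Rightarrow> nat \<Rightarrow> complex) \<Rightarrow> complex" where
  "hform m n H x = (\<Sum>I\<in>midx m n. \<Sum>J\<in>midx m n.
       H I J * cnj (\<Prod>k<m. x k (I k)) * (\<Prod>k<m. x k (J k)))"

definition C_psd :: "nat \<Rightarrow> (nat \<Rightarrow> nat) \<Rightarrow> ctensor \<Rightarrow> bool" where
  "C_psd m n H \<longleftrightarrow> herm_tensor m n H \<and> (\<forall>x. Re (hform m n H x) \<ge> 0)"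

definition C_pd :: "nat \<Rightarrow> (nat \<Rightarrow> nat) \<Rightarrow> ctensor \<Rightarrow> bool" where
  "C_pd m n H \<longleftrightarrow> herm_tensor m n H \<and>
     (\<forall>x. (\<forall>i<m. \<exists>j<n i. x i j \<noteq> 0) \<longrightarrow> Re (hform m n H x) > 0)"

definition cmonom :: "nat \<Rightarrow> (nat \<Rightarrow> nat) \<Rightarrow> (nat \<Rightarrow> nat \<Rightarrow> nat) \<Rightarrow> (nat \<Rightarrow> nat \<Rightarrow> complex) \<Rightarrow> complex" where
  "cmonom m n \<alpha> x = (\<Prod>k<m. \<Prod>j<n k. x k j ^ \<alpha> k j)"

definition is_cpoly :: "nat \<Rightarrow> (nat \<Rightarrow> nat) \<Rightarrow> ((nat \<Rightarrow> nat \<Rightarrow> complex) \<Rightarrow> complex) \<Rightarrow> bool" where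
  "is_cpoly m n p \<longleftrightarrow> (\<exists>A c. finite A \<and> (\<forall>x. p x = (\<Sum>\<alpha>\<in>A. c \<alpha> * cmonom m n \<alpha> x)))"

definition herm_sos :: "nat \<Rightarrow> (nat \<Rightarrow> nat) \<Rightarrow> ((nat \<Rightarrow> nat \<Rightarrow> complex) \<Rightarrow> real) \<Rightarrow> bool" where
  "herm_sos m n f \<longleftrightarrow> (\<exists>(L::nat) p. (\<forall>l<L. is_cpoly m n (p l)) \<and>
      (\<forall>x. f x = (\<Sum>l<L. (cmod (p l x))\<^sup>2)))"

definition blocknorm2 :: "(nat \<Rightarrow> nat) \<Rightarrow> (nat \<Rightarrow> nat \<Rightarrow> complex) \<Rightarrow> nat \<Rightarrow> real" where
  "blocknorm2 n x i = (\<Sum>j<n i. (cmod (x i j))\<^sup>2)"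

definition Omega_C :: "nat \<Rightarrow> (nat \<Rightarrow> nat) \<Rightarrow> (nat \<Rightarrow> nat) \<Rightarrow> ctensor set" where
  "Omega_C m n k = {H. herm_tensor m n H \<and>
      herm_sos m n (\<lambda>x. (\<Prod>i<m. blocknorm2 n x i ^ k i) * Re (hform m n H x))}"

definition psd_cone :: "nat \<Rightarrow> (nat \<Rightarrow> nat) \<Rightarrow> ctensor set" where
  "psd_cone m n = {H. C_psd m n H}"

definition tdist :: "nat \<Rightarrow> (nat \<Rightarrow> nat) \<Rightarrow> ctensor \<Rightarrow> ctensor \<Rightarrow> real" where
  "tdist m n H G = sqrt (\<Sum>I\<in>midx m n. \<Sum>J\<in>midx m n. (cmod (H I J - G I J))\<^sup>2)"

definition tinterior :: "nat \<Rightarrow> (nat \<Rightarrow> nat) \<Rightarrow> ctensor set \<Rightarrow> ctensor set" where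
  "tinterior m n S = {H. herm_tensor m n H \<and> (\<exists>e>0. \<forall>G. herm_tensor m n G \<and> tdist m n H G < e \<longrightarrow> G \<in> S)}"

end

theory Submission
  imports Defs "HOL-Probability.Probability"
begin

text \<open>
  Let \<open>u\<close> be a vector of independent standard complex Gaussians. Gaussian integration by parts gives,
  for one block of dimension \<open>d\<close>, that the average of \<open>cnj (u\<^sub>i) u\<^sub>j |\<langle>x, u\<rangle>|^(2N)\<close> equals
  \<open>N! (N |x|^(2N-2) cnj (x\<^sub>i) x\<^sub>j + \<delta>\<^sub>i\<^sub>j |x|^(2N))\<close>. Subtracting from \<open>H\<close> in each block a multiple
  \<open>1 / (N + d)\<close> of its partial trace removes the \<open>\<delta>\<close>-terms, and so yields tensors \<open>F\<^sub>N\<close> tending to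
  \<open>H\<close> for which the average of \<open>F\<^sub>N(u, cnj u) \<Prod>|\<langle>x\<^sub>k, u\<^sub>k\<rangle>|^(2N)\<close> is a positive multiple of
  \<open>\<Prod>|x\<^sub>k|^(2N-2) H(x, cnj x)\<close>. By compactness of the product of spheres \<open>F\<^sub>N\<close> is psd for large
  \<open>N\<close>; the average is then given by a psd matrix in the monomials of \<open>x\<close>, hence is a Hermitian
  sum of squares. An interior point \<open>H\<close> of the psd cone is positive definite because \<open>H - t I\<close> is
  psd for small \<open>t\<close>, and \<open>I(x, cnj x) = \<Prod>|x\<^sub>k|^2\<close>.
\<close>

subsection \<open>Psd matrices are sums of squares\<close>

text \<open>Induction on the index set by completing the square. A positive diagonal entry at
  \<open>s\<close> splits off one square and leaves a psd Schur complement on \<open>S\<close>; a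
  zero diagonal entry leaves the form on \<open>S\<close> unchanged.\<close>

lemma psd_matrix_sos:
  fixes M :: "'a \<Rightarrow> 'a \<Rightarrow> complex"
  assumes "finite S"
    and "\<And>a b. a \<in> S \<Longrightarrow> b \<in> S \<Longrightarrow> M a b = cnj (M b a)"
    and "\<And>y. Re (\<Sum>a\<in>S. \<Sum>b\<in>S. M a b * cnj (y a) * y b) \<ge> 0"
  shows "\<exists>(L::nat) v. \<forall>y. (\<Sum>a\<in>S. \<Sum>b\<in>S. M a b * cnj (y a) * y b)
           = of_real (\<Sum>l<L. (cmod (\<Sum>a\<in>S. v l a * y a))\<^sup>2)"
  using assms
proof (induction S arbitrary: M rule: finite_induct)
  case empty
  show ?case by (intro exI[of _ 0]) simp
next
  case (insert s S)
  note herm = insert.prems(1) and psd = insert.prems(2)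
  define r where "r = Re (M s s)"
  have Mss: "M s s = of_real r"
    using herm[of s s] unfolding r_def by (simp add: complex_eq_iff)
  have split: "(\<Sum>a\<in>insert s S. \<Sum>b\<in>insert s S. M a b * cnj (y a) * y b)
      = of_real r * (cnj (y s) * y s) + cnj (y s) * (\<Sum>b\<in>S. M s b * y b) + y s * cnj (\<Sum>b\<in>S. M s b * y b)
        + (\<Sum>a\<in>S. \<Sum>b\<in>S. M a b * cnj (y a) * y b)" for y
  proof -
    have "(\<Sum>a\<in>S. M a s * cnj (y a) * y s) = y s * cnj (\<Sum>b\<in>S. M s b * y b)"
      unfolding cnj_sum sum_distrib_left
      by (intro sum.cong refl, subst herm) (auto simp: mult_ac)
    moreover have "(\<Sum>b\<in>S. M s b * cnj (y s) * y b) = cnj (y s) * (\<Sum>b\<in>S. M s b * y b)"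
      by (simp add: sum_distrib_left mult_ac)
    ultimately show ?thesis
      using insert.hyps by (simp add: sum.distrib Mss algebra_simps)
  qed
  have r0: "r \<ge> 0"
  proof -
    \<comment> \<open>Testing the form on the unit vector at \<open>s\<close> isolates the diagonal
      entry \<open>r\<close>.\<close>
    have "(\<Sum>b\<in>S. M s b * (if b = s then 1 else 0)) = 0"
      "(\<Sum>a\<in>S. \<Sum>b\<in>S. M a b * cnj (if a = s then 1 else 0) * (if b = s then 1 else 0)) = 0"
      using insert.hyps by (auto intro!: sum.neutral)
    then show ?thesis
      using psd[of "\<lambda>a. if a = s then 1 else 0"] unfolding split by simp
  qed
  have upd: "(\<Sum>b\<in>S. M a b * (y(s := c)) b) = (\<Sum>b\<in>S. M a b * y b)" for y c a
    using insert.hyps by (intro sum.cong) auto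
  have upd2: "(\<Sum>a\<in>S. \<Sum>b\<in>S. M a b * cnj ((y(s := c)) a) * (y(s := c)) b)
        = (\<Sum>a\<in>S. \<Sum>b\<in>S. M a b * cnj (y a) * y b)" for y c
    using insert.hyps by (intro sum.cong) auto
  have updv: "(\<Sum>a\<in>S. (if a = s then (0::complex) else v l a) * y a) = (\<Sum>a\<in>S. v l a * y a)" for v :: "nat \<Rightarrow> 'a \<Rightarrow> complex" and l y
    using insert.hyps by (intro sum.cong) auto
  show ?case
  proof (cases "r = 0")
    case True
    \<comment> \<open>A zero diagonal entry of a psd matrix forces its whole row to vanish.\<close>
    have row: "(\<Sum>b\<in>S. M s b * y b) = 0" for y
    proof (rule ccontr)
      define z where "z = (\<Sum>b\<in>S. M s b * y b)"
      define q where "q = Re (\<Sum>a\<in>S. \<Sum>b\<in>S. M a b * cnj (y a) * y b)"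
      assume "(\<Sum>b\<in>S. M s b * y b) \<noteq> 0"
      then have z: "(cmod z)\<^sup>2 > 0" by (simp add: z_def)
      \<comment> \<open>At \<open>y(s := t z)\<close> the form equals \<open>2 t |z|^2 + q\<close>;
        this \<open>t\<close> makes it \<open>q - |q| - 1\<close>, which is negative.\<close>
      define t where "t = - (\<bar>q\<bar> + 1) / (2 * (cmod z)\<^sup>2)"
      have "0 \<le> Re (cnj (of_real t * z) * z + (of_real t * z) * cnj z) + q"
        using psd[of "y(s := of_real t * z)"] unfolding split upd upd2 z_def[symmetric] q_def True
        by simp
      also have "cnj (of_real t * z) * z + (of_real t * z) * cnj z = of_real (2 * t * (cmod z)\<^sup>2)"
        unfolding of_real_mult complex_norm_square by (simp add: mult_ac)
      also have "2 * t * (cmod z)\<^sup>2 = - (\<bar>q\<bar> + 1)"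
        using z by (simp add: t_def field_simps)
      finally show False by simp
    qed
    obtain L :: nat and v where v: "\<And>y. (\<Sum>a\<in>S. \<Sum>b\<in>S. M a b * cnj (y a) * y b)
           = of_real (\<Sum>l<L. (cmod (\<Sum>a\<in>S. v l a * y a))\<^sup>2)"
    proof -
      have "Re (\<Sum>a\<in>S. \<Sum>b\<in>S. M a b * cnj (y a) * y b) \<ge> 0" for y
        using psd[of y] unfolding split row True by simp
      with insert.IH[of M] herm that show ?thesis by blast
    qed
    show ?thesis
      unfolding split row True v using insert.hyps
      by (intro exI[of _ L] exI[of _ "\<lambda>l a. if a = s then 0 else v l a"]) (simp add: updv)
  next
    case False
    with r0 have r: "r > 0" by simp
    \<comment> \<open>The Schur complement of the diagonal entry \<open>r\<close>.\<close>
    define M' where "M' a b = M a b - M a s * M s b / of_real r" for a b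
    have sq: "(\<Sum>a\<in>S. \<Sum>b\<in>S. M' a b * cnj (y a) * y b) =
       (\<Sum>a\<in>S. \<Sum>b\<in>S. M a b * cnj (y a) * y b)
       - cnj (\<Sum>b\<in>S. M s b * y b) * (\<Sum>b\<in>S. M s b * y b) / of_real r" for y
    proof -
      have "cnj (\<Sum>b\<in>S. M s b * y b) = (\<Sum>a\<in>S. M a s * cnj (y a))"
        unfolding cnj_sum by (intro sum.cong refl, subst herm[of _ s]) auto
      then have "cnj (\<Sum>b\<in>S. M s b * y b) * (\<Sum>b\<in>S. M s b * y b) / of_real r
         = (\<Sum>a\<in>S. \<Sum>b\<in>S. M a s * M s b / of_real r * cnj (y a) * y b)"
        by (simp only: sum_product sum_divide_distrib) (simp add: mult_ac)
      then show ?thesis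
        by (simp add: M'_def left_diff_distrib sum_subtractf)
    qed
    have complete: "(\<Sum>a\<in>insert s S. \<Sum>b\<in>insert s S. M a b * cnj (y a) * y b)
      = of_real ((cmod (of_real (sqrt r) * y s + (\<Sum>b\<in>S. M s b * y b) / of_real (sqrt r)))\<^sup>2)
        + (\<Sum>a\<in>S. \<Sum>b\<in>S. M' a b * cnj (y a) * y b)" for y
    proof -
      define z where "z = (\<Sum>b\<in>S. M s b * y b)"
      have rr: "complex_of_real r = of_real (sqrt r) * of_real (sqrt r)"
        using r by (simp flip: of_real_mult)
      have s0: "complex_of_real (sqrt r) \<noteq> 0" using r by simp
      have "of_real ((cmod (of_real (sqrt r) * y s + z / of_real (sqrt r)))\<^sup>2)
         = of_real r * (cnj (y s) * y s) + cnj (y s) * z + y s * cnj z + cnj z * z / of_real r"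
        unfolding complex_norm_square rr using s0 by (simp add: field_simps)
      then show ?thesis unfolding split sq z_def by simp
    qed
    obtain L :: nat and v where v: "\<And>y. (\<Sum>a\<in>S. \<Sum>b\<in>S. M' a b * cnj (y a) * y b)
           = of_real (\<Sum>l<L. (cmod (\<Sum>a\<in>S. v l a * y a))\<^sup>2)"
    proof -
      have h: "M' a b = cnj (M' b a)" if "a \<in> S" "b \<in> S" for a b
      proof -
        have "M a b = cnj (M b a)" "M a s = cnj (M s a)" "M s b = cnj (M b s)"
          using herm that by blast+
        then show ?thesis by (simp add: M'_def)
      qed
      have "Re (\<Sum>a\<in>S. \<Sum>b\<in>S. M' a b * cnj (y a) * y b) \<ge> 0" for y
      proof -
        \<comment> \<open>The value at \<open>s\<close> is the one for which the completed square
          vanishes, so nonnegativity of \<open>M\<close> at \<open>y'\<close> becomes nonnegativity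
          of \<open>M'\<close> at \<open>y\<close>.\<close>
        define y' where "y' = y(s := - (\<Sum>b\<in>S. M s b * y b) / of_real r)"
        have "(\<Sum>a\<in>S. \<Sum>b\<in>S. M' a b * cnj (y' a) * y' b) = (\<Sum>a\<in>S. \<Sum>b\<in>S. M' a b * cnj (y a) * y b)"
          using insert.hyps unfolding y'_def by (intro sum.cong) auto
        moreover have "of_real (sqrt r) * y' s + (\<Sum>b\<in>S. M s b * y' b) / of_real (sqrt r) = 0"
        proof -
          have rr: "complex_of_real r = of_real (sqrt r) * of_real (sqrt r)"
            using r by (simp flip: of_real_mult)
          have s0: "complex_of_real (sqrt r) \<noteq> 0" using r by simp
          show ?thesis unfolding y'_def upd fun_upd_same rr using s0 by (simp add: field_simps)
        qed
        ultimately show ?thesis using psd[of y'] unfolding complete by simp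
      qed
      with insert.IH[of M'] h that show ?thesis by blast
    qed
    define v' where "v' l a = (case l of 0 \<Rightarrow> if a = s then of_real (sqrt r) else M s a / of_real (sqrt r)
        | Suc l \<Rightarrow> if a = s then 0 else v l a)" for l a
    have v0: "(\<Sum>a\<in>insert s S. v' 0 a * y a) = of_real (sqrt r) * y s + (\<Sum>b\<in>S. M s b * y b) / of_real (sqrt r)" for y
    proof -
      have "(\<Sum>a\<in>S. v' 0 a * y a) = (\<Sum>b\<in>S. M s b * y b) / of_real (sqrt r)"
        using insert.hyps unfolding sum_divide_distrib by (intro sum.cong) (auto simp: v'_def)
      then show ?thesis using insert.hyps by (simp add: v'_def)
    qed
    have vS: "(\<Sum>a\<in>insert s S. v' (Suc l) a * y a) = (\<Sum>a\<in>S. v l a * y a)" for l y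
      using insert.hyps by (simp add: v'_def updv)
    show ?thesis
      unfolding complete v
      by (intro exI[of _ "Suc L"] exI[of _ v']) (simp add: sum.lessThan_Suc_shift v0 vS del: sum.lessThan_Suc sum.insert)
  qed
qed

subsection \<open>Complex Gaussian moments\<close>

text \<open>The standard complex Gaussian in polar coordinates: the modulus and the angle are independent,
  so its mixed moments factor into one-dimensional integrals.\<close>

definition rayleigh_density :: "real \<Rightarrow> real" where
  "rayleigh_density r = 2 * (indicator {0..} r * (exp (- r\<^sup>2) * r))"

definition angle_density :: "real \<Rightarrow> real" where
  "angle_density t = indicator {0..2 * pi} t / (2 * pi)"

text \<open>Indexing by \<open>bool\<close>, with \<open>True\<close> for the modulus and
  \<open>False\<close> for the angle, lets the finite product rules for \<open>PiM\<close> express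
  independence.\<close>

definition polar_measure :: "(bool \<Rightarrow> real) measure" where
  "polar_measure = PiM UNIV (\<lambda>b. density lborel (if b then rayleigh_density else angle_density))"

definition cgauss :: "complex measure" where
  "cgauss = distr polar_measure borel (\<lambda>w. of_real (w True) * cis (w False))"

lemma prob_space_density_lborel:
  fixes f :: "real \<Rightarrow> real"
  assumes "has_bochner_integral lborel f 1" "\<And>x. f x \<ge> 0"
  shows "prob_space (density lborel f)"
proof
  have [measurable]: "f \<in> borel_measurable borel"
    using assms(1) by (auto simp: has_bochner_integral_iff)
  have "emeasure (density lborel f) (space (density lborel f)) = (\<integral>\<^sup>+ x. ennreal (f x) \<partial>lborel)"
    by (simp add: emeasure_density)
  also have "\<dots> = 1"
    using assms by (subst nn_integral_eq_integral) (auto simp: has_bochner_integral_iff)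
  finally show "emeasure (density lborel f) (space (density lborel f)) = 1" .
qed

lemma rayleigh_density_nonneg: "rayleigh_density r \<ge> 0"
  by (simp add: rayleigh_density_def indicator_def)

lemma angle_density_nonneg: "angle_density t \<ge> 0"
  by (simp add: angle_density_def)

lemma rayleigh_even_moment:
  "has_bochner_integral lborel (\<lambda>r. rayleigh_density r * r ^ (2 * k)) (fact k)"
  using has_bochner_integral_mult_right[OF gaussian_moment_odd_pos[of k], of 2]
  by (simp add: rayleigh_density_def mult_ac power_add)

text \<open>Odd moments occur in mixed moments with exponents of different parity. Only their
  finiteness matters there, because the angular factor is 0.\<close>

lemma rayleigh_integrable: "integrable lborel (\<lambda>r. rayleigh_density r * r ^ k)"
proof (cases "even k")
  case True
  then show ?thesis using rayleigh_even_moment[of "k div 2"] by (auto simp: has_bochner_integral_iff)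
next
  case False
  then have "Suc k = 2 * (Suc k div 2)" by presburger
  then show ?thesis
    using has_bochner_integral_mult_right[OF gaussian_moment_even_pos[of "Suc k div 2"], of 2]
    by (simp add: has_bochner_integral_iff rayleigh_density_def mult_ac)
qed

lemma angle_character_integral:
  "has_bochner_integral lborel (\<lambda>t. angle_density t *\<^sub>R cis ((real b - real a) * t)) (if a = b then 1 else 0)"
proof (cases "a = b")
  case True
  have "has_bochner_integral lborel (\<lambda>t. indicator {0..2 * pi} t *\<^sub>R (1::complex)) (of_real (2 * pi) - of_real 0)"
    by (rule has_bochner_integral_FTC_Icc) (auto intro!: derivative_eq_intros)
  from has_bochner_integral_scaleR_right[OF this, of "1 / (2 * pi)"]
  show ?thesis using True by (simp add: angle_density_def scaleR_conv_of_real)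
next
  case False
  define k where "k = real b - real a"
  have k: "k \<noteq> 0" using False by (simp add: k_def)
  \<comment> \<open>Since \<open>k\<close> is an integer, the primitive takes equal values at both
    ends of the interval.\<close>
  have per: "cis (k * (2 * pi)) = 1"
  proof -
    have "k * (2 * pi) = 2 * pi * of_int (int b - int a)" by (simp add: k_def)
    then show ?thesis by (simp only: cis_multiple_2pi Ints_of_int)
  qed
  have "has_bochner_integral lborel (\<lambda>t. indicator {0..2 * pi} t *\<^sub>R cis (k * t))
        (cis (k * (2 * pi)) / (\<i> * of_real k) - cis (k * 0) / (\<i> * of_real k))"
  proof (rule has_bochner_integral_FTC_Icc)
    fix x :: real
    have "((\<lambda>x. cis (k * x)) has_vector_derivative k *\<^sub>R (\<i> * cis (k * x))) (at x within {0..2 * pi})"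
    proof -
      have "((\<lambda>x. exp (\<i> * (of_real k * of_real x))) has_vector_derivative
          (of_real k * \<i> * exp (\<i> * (of_real k * of_real x)))) (at x within {0..2 * pi})"
        by (rule has_vector_derivative_real_field) (auto intro!: derivative_eq_intros simp: mult_ac)
      then show ?thesis by (simp add: cis_conv_exp scaleR_conv_of_real mult_ac)
    qed
    then show "((\<lambda>x. cis (k * x) / (\<i> * of_real k)) has_vector_derivative cis (k * x)) (at x within {0..2 * pi})"
      using k by (auto intro!: derivative_eq_intros simp: scaleR_conv_of_real)
  qed (auto intro!: continuous_intros)
  from has_bochner_integral_scaleR_right[OF this[unfolded per], of "1 / (2 * pi)"]
  show ?thesis using False by (simp add: angle_density_def k_def)
qed

lemma prob_space_rayleigh: "prob_space (density lborel rayleigh_density)"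
  using rayleigh_even_moment[of 0] by (intro prob_space_density_lborel rayleigh_density_nonneg) simp

lemma prob_space_angle: "prob_space (density lborel angle_density)"
proof (intro prob_space_density_lborel angle_density_nonneg)
  show "has_bochner_integral lborel angle_density 1"
    using has_bochner_integral_bounded_linear[OF bounded_linear_Re angle_character_integral[of 0 0]] by simp
qed

lemma polar_measurable:
  fixes D :: "bool \<Rightarrow> real measure"
  assumes "\<And>b. sets (D b) = sets borel"
  shows "(\<lambda>w. of_real (w True) * cis (w False)) \<in> borel_measurable (PiM UNIV D)"
proof -
  have [measurable]: "(\<lambda>w. w b) \<in> borel_measurable (PiM UNIV D)" for b
    using measurable_component_singleton[of b UNIV D]
      measurable_cong_sets[OF refl assms[of b], of "PiM UNIV D"] by simp
  have [measurable]: "cis \<in> borel_measurable borel"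
    by (intro borel_measurable_continuous_onI continuous_intros)
  show ?thesis by measurable
qed

lemma prob_space_cgauss: "prob_space cgauss"
proof -
  have "prob_space polar_measure"
    unfolding polar_measure_def
    by (intro prob_space_PiM) (auto simp: prob_space_rayleigh prob_space_angle)
  then show ?thesis
    unfolding cgauss_def by (rule prob_space.prob_space_distr) (auto simp: polar_measure_def intro!: polar_measurable)
qed

text \<open>In polar coordinates the integrand is \<open>r^(a+b)\<close> times the character of
  frequency \<open>b - a\<close>. The angular integral vanishes unless \<open>a = b\<close>, and
  then the radial one is the even moment \<open>a!\<close>.\<close>

lemma cgauss_moment:
  "has_bochner_integral cgauss (\<lambda>z. cnj z ^ a * z ^ b) (if a = b then fact a else 0)"
proof -
  define D where "D b = density lborel (if b then rayleigh_density else angle_density)" for b :: bool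
  have pD: "prob_space (D b)" for b by (auto simp: D_def prob_space_rayleigh prob_space_angle)
  interpret product_sigma_finite D
    using pD by (intro product_sigma_finite.intro) (auto intro: prob_space_imp_sigma_finite)
  define f :: "bool \<Rightarrow> real \<Rightarrow> complex" where
    "f v x = (if v then of_real (x ^ (a + b)) else cis ((real b - real a) * x))" for v x
  have [measurable]: "rayleigh_density \<in> borel_measurable borel" "angle_density \<in> borel_measurable borel"
    unfolding rayleigh_density_def[abs_def] angle_density_def[abs_def] by measurable
  have cis_m [measurable]: "cis \<in> borel_measurable borel"
    by (intro borel_measurable_continuous_onI continuous_intros)
  have fT: "integrable (D True) (f True)" "integral\<^sup>L (D True) (f True) = of_real (\<integral>r. rayleigh_density r * r ^ (a + b) \<partial>lborel)"
  proof -
    have "integrable lborel (\<lambda>r. of_real (rayleigh_density r * r ^ (a + b)) :: complex)"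
      using rayleigh_integrable by (rule integrable_of_real)
    then show "integrable (D True) (f True)"
      unfolding D_def f_def by (subst integrable_density) (auto simp: rayleigh_density_nonneg scaleR_conv_of_real)
    show "integral\<^sup>L (D True) (f True) = of_real (\<integral>r. rayleigh_density r * r ^ (a + b) \<partial>lborel)"
      unfolding D_def f_def
      by (subst integral_density) (auto simp: rayleigh_density_nonneg scaleR_conv_of_real simp flip: integral_complex_of_real)
  qed
  have fF: "integrable (D False) (f False)" "integral\<^sup>L (D False) (f False) = (if a = b then 1 else 0)"
  proof -
    show "integrable (D False) (f False)"
      using angle_character_integral[of b a] unfolding D_def f_def
      by (subst integrable_density) (auto simp: angle_density_nonneg has_bochner_integral_iff)
    show "integral\<^sup>L (D False) (f False) = (if a = b then 1 else 0)"
      using angle_character_integral[of b a] unfolding D_def f_def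
      by (subst integral_density) (auto simp: angle_density_nonneg has_bochner_integral_iff)
  qed
  have int: "integrable (D v) (f v)" for v using fT fF by (cases v) auto
  have eq: "cnj (of_real (w True) * cis (w False)) ^ a * (of_real (w True) * cis (w False)) ^ b
      = (\<Prod>v\<in>UNIV. f v (w v))" for w :: "bool \<Rightarrow> real"
  proof -
    have "cnj (cis (w False)) ^ a * cis (w False) ^ b = cis ((real b - real a) * w False)"
      by (simp add: cis_cnj Complex.DeMoivre cis_mult algebra_simps)
    then show ?thesis by (simp add: UNIV_bool f_def power_mult_distrib power_add mult_ac)
  qed
  have P: "polar_measure = PiM UNIV D" by (simp add: polar_measure_def D_def[abs_def])
  have "has_bochner_integral (PiM UNIV D) (\<lambda>w. \<Prod>v\<in>UNIV. f v (w v)) (if a = b then fact a else 0)"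
    using product_integrable_prod[of UNIV f] product_integral_prod[of UNIV f] int fT(2) fF(2)
      rayleigh_even_moment[of a]
    by (auto simp: has_bochner_integral_iff UNIV_bool mult_2)
  then show ?thesis
    unfolding cgauss_def P eq[symmetric]
    by (intro has_bochner_integral_distr borel_measurable_continuous_onI)
       (auto simp: D_def intro!: polar_measurable continuous_intros)
qed

subsection \<open>Gaussian integration by parts\<close>

definition gvec :: "nat \<Rightarrow> (nat \<Rightarrow> complex) measure" where
  "gvec d = PiM {..<d} (\<lambda>_. cgauss)"

definition mono2 :: "nat \<Rightarrow> (nat \<Rightarrow> nat) \<Rightarrow> (nat \<Rightarrow> nat) \<Rightarrow> (nat \<Rightarrow> complex) \<Rightarrow> complex" where
  "mono2 d a b u = (\<Prod>l<d. cnj (u l) ^ a l * u l ^ b l)"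

lemma prob_space_gvec: "prob_space (gvec d)"
  unfolding gvec_def by (intro prob_space_PiM prob_space_cgauss)

lemma gvec_moment:
  "has_bochner_integral (gvec d) (mono2 d a b) (\<Prod>l<d. if a l = b l then fact (a l) else 0)"
proof -
  interpret product_sigma_finite "\<lambda>_::nat. cgauss"
    by (intro product_sigma_finite.intro prob_space_imp_sigma_finite prob_space_cgauss)
  have "integrable cgauss (\<lambda>z. cnj z ^ a l * z ^ b l)"
    "integral\<^sup>L cgauss (\<lambda>z. cnj z ^ a l * z ^ b l) = (if a l = b l then fact (a l) else 0)" for l
    using cgauss_moment[of "a l" "b l"] by (auto simp: has_bochner_integral_iff)
  then show ?thesis
    using product_integrable_prod[of "{..<d}" "\<lambda>l z. cnj z ^ a l * z ^ b l"]
      product_integral_prod[of "{..<d}" "\<lambda>l z. cnj z ^ a l * z ^ b l"]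
    by (simp add: gvec_def mono2_def[abs_def] has_bochner_integral_iff)
qed

lemma mono2_times_var:
  assumes "l < d" shows "mono2 d a b u * u l = mono2 d a (b(l := Suc (b l))) u"
proof -
  have "{..<d} = insert l ({..<d} - {l})" using assms by auto
  then have *: "(\<Prod>k<d. f k) = f l * (\<Prod>k\<in>{..<d} - {l}. f k)" for f :: "nat \<Rightarrow> complex"
    by (metis prod.insert Diff_iff finite_Diff finite_lessThan insertI1)
  show ?thesis unfolding mono2_def * by (simp add: mult_ac)
qed

lemma mono2_times_cnj:
  assumes "l < d" shows "mono2 d a b u * cnj (u l) = mono2 d (a(l := Suc (a l))) b u"
proof -
  have "{..<d} = insert l ({..<d} - {l})" using assms by auto
  then have *: "(\<Prod>k<d. f k) = f l * (\<Prod>k\<in>{..<d} - {l}. f k)" for f :: "nat \<Rightarrow> complex"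
    by (metis prod.insert Diff_iff finite_Diff finite_lessThan insertI1)
  show ?thesis unfolding mono2_def * by (simp add: mult_ac)
qed

text \<open>Gaussian integration by parts: \<open>cnj (u i)\<close> acts under the integral as the derivative in
  \<open>u i\<close>, so \<open>g'\<close> plays the role of \<open>\<partial>g/\<partial>u\<^sub>i\<close>.
  Quantifying over all monomial factors makes the relation stable under multiplication by coordinates.
  If \<open>b i = 0\<close>, the truncated exponent \<open>b i - 1\<close> is harmless since its term has coefficient 0.\<close>

definition stein :: "nat \<Rightarrow> nat \<Rightarrow> ((nat \<Rightarrow> complex) \<Rightarrow> complex) \<Rightarrow> ((nat \<Rightarrow> complex) \<Rightarrow> complex) \<Rightarrow> bool" where
  "stein d i g g' \<longleftrightarrow> (\<forall>a b. integrable (gvec d) (\<lambda>u. mono2 d a b u * g u)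
      \<and> integrable (gvec d) (\<lambda>u. mono2 d a b u * g' u)
      \<and> (\<integral>u. mono2 d (a(i := Suc (a i))) b u * g u \<partial>gvec d)
        = of_nat (b i) * (\<integral>u. mono2 d a (b(i := b i - 1)) u * g u \<partial>gvec d)
          + (\<integral>u. mono2 d a b u * g' u \<partial>gvec d))"

lemma steinD:
  assumes "stein d i g g'"
  shows "integrable (gvec d) (\<lambda>u. mono2 d a b u * g u)"
    "integrable (gvec d) (\<lambda>u. mono2 d a b u * g' u)"
    "(\<integral>u. mono2 d (a(i := Suc (a i))) b u * g u \<partial>gvec d)
        = of_nat (b i) * (\<integral>u. mono2 d a (b(i := b i - 1)) u * g u \<partial>gvec d)
          + (\<integral>u. mono2 d a b u * g' u \<partial>gvec d)"
  using assms by (auto simp: stein_def)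

text \<open>Read off from the explicit moments. For \<open>b i = Suc c\<close> it is the recursion
  \<open>fact (Suc c) = Suc c * fact c\<close>; for \<open>b i = 0\<close> the left side vanishes
  because the exponents of coordinate \<open>i\<close> differ.\<close>

lemma stein_one:
  assumes "i < d" shows "stein d i (\<lambda>_. 1) (\<lambda>_. 0)"
proof -
  have "{..<d} = insert i ({..<d} - {i})" using assms by auto
  then have *: "(\<Prod>k<d. f k) = f i * (\<Prod>k\<in>{..<d} - {i}. f k)" for f :: "nat \<Rightarrow> complex"
    by (metis prod.insert Diff_iff finite_Diff finite_lessThan insertI1)
  have "integral\<^sup>L (gvec d) (mono2 d (a(i := Suc (a i))) b)
     = of_nat (b i) * integral\<^sup>L (gvec d) (mono2 d a (b(i := b i - 1)))" for a b
  proof (cases "b i")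
    case 0
    then show ?thesis
      unfolding has_bochner_integral_integral_eq[OF gvec_moment] * by simp
  next
    case (Suc c)
    have "(\<Prod>k\<in>{..<d} - {i}. if (a(i := Suc (a i))) k = b k then fact ((a(i := Suc (a i))) k) else 0)
       = (\<Prod>k\<in>{..<d} - {i}. if a k = (b(i := b i - 1)) k then fact (a k) else (0::complex))"
      by (intro prod.cong) auto
    then show ?thesis
      unfolding has_bochner_integral_integral_eq[OF gvec_moment] * using Suc by simp
  qed
  then show ?thesis
    using gvec_moment[of d] by (auto simp: stein_def has_bochner_integral_iff)
qed

text \<open>The product rule. The factor \<open>u l\<close> is absorbed into the arbitrary monomial
  by raising \<open>b l\<close>, so the relation for \<open>g\<close> applies directly.\<close>

lemma stein_var:
  assumes g: "stein d i g g'" and l: "l < d"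
  shows "stein d i (\<lambda>u. u l * g u) (\<lambda>u. of_bool (l = i) * g u + u l * g' u)"
  unfolding stein_def
proof (intro allI conjI)
  fix a b :: "nat \<Rightarrow> nat"
  define b' where "b' = b(l := Suc (b l))"
  have *: "mono2 d a b u * (u l * h) = mono2 d a b' u * h" for a u h
    using mono2_times_var[OF l, of a b u] by (simp add: b'_def flip: mult.assoc)
  have int: "integrable (gvec d) (\<lambda>u. mono2 d a b u * g u)" "integrable (gvec d) (\<lambda>u. mono2 d a b' u * g u)"
    "integrable (gvec d) (\<lambda>u. mono2 d a b' u * g' u)"
    using steinD[OF g] by auto
  show "integrable (gvec d) (\<lambda>u. mono2 d a b u * (u l * g u))"
    unfolding * by (rule int)
  have **: "mono2 d a b u * (of_bool (l = i) * g u + u l * g' u)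
       = of_bool (l = i) * (mono2 d a b u * g u) + mono2 d a b' u * g' u" for u
    by (simp add: distrib_left *)
  show "integrable (gvec d) (\<lambda>u. mono2 d a b u * (of_bool (l = i) * g u + u l * g' u))"
    unfolding ** by (intro Bochner_Integration.integrable_add integrable_mult_right int)
  \<comment> \<open>Raising \<open>b l\<close> changes the coefficient \<open>b i\<close> only when
    \<open>l = i\<close>; the extra unit is the derivative of \<open>u l\<close>.\<close>
  have "of_nat (b' i) * (\<integral>u. mono2 d a (b'(i := b' i - 1)) u * g u \<partial>gvec d)
    = of_nat (b i) * (\<integral>u. mono2 d a (b(i := b i - 1)) u * (u l * g u) \<partial>gvec d)
      + of_bool (l = i) * (\<integral>u. mono2 d a b u * g u \<partial>gvec d)"
  proof (cases "l = i")
    case True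
    then have b': "b'(i := b' i - 1) = b" "b' i = Suc (b i)" by (auto simp: b'_def)
    have "of_nat (b i) * (mono2 d a (b(i := b i - 1)) u * (u l * g u)) = of_nat (b i) * (mono2 d a b u * g u)" for u
    proof (cases "b i = 0")
      case False
      then have "mono2 d a (b(i := b i - 1)) u * u l = mono2 d a b u"
        using mono2_times_var[OF l, of a "b(i := b i - 1)" u] True by simp
      then show ?thesis by (simp flip: mult.assoc)
    qed simp
    then have "of_nat (b i) * (\<integral>u. mono2 d a (b(i := b i - 1)) u * (u l * g u) \<partial>gvec d)
       = of_nat (b i) * (\<integral>u. mono2 d a b u * g u \<partial>gvec d)"
      unfolding integral_mult_right_zero[symmetric] by (simp only:)
    then show ?thesis unfolding b'(1) unfolding b'(2) using True by (auto simp: algebra_simps)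
  next
    case False
    then have b': "b'(i := b' i - 1) = (b(i := b i - 1))(l := Suc ((b(i := b i - 1)) l))" "b' i = b i"
      by (auto simp: b'_def fun_eq_iff)
    show ?thesis
      unfolding b'(1) unfolding b'(2) mono2_times_var[OF l, symmetric] using False by (simp add: mult.assoc)
  qed
  then show "(\<integral>u. mono2 d (a(i := Suc (a i))) b u * (u l * g u) \<partial>gvec d)
     = of_nat (b i) * (\<integral>u. mono2 d a (b(i := b i - 1)) u * (u l * g u) \<partial>gvec d)
       + (\<integral>u. mono2 d a b u * (of_bool (l = i) * g u + u l * g' u) \<partial>gvec d)"
    unfolding * ** steinD(3)[OF g] by (subst Bochner_Integration.integral_add) (auto simp: int)
qed

text \<open>A conjugate coordinate is a constant for the Wirtinger derivative, even for
  \<open>l = i\<close>. Here this means that the two increments of the exponent \<open>a\<close>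
  commute.\<close>

lemma stein_cnj:
  assumes g: "stein d i g g'" and l: "l < d"
  shows "stein d i (\<lambda>u. cnj (u l) * g u) (\<lambda>u. cnj (u l) * g' u)"
proof -
  have *: "mono2 d a b u * (cnj (u l) * h) = mono2 d (a(l := Suc (a l))) b u * h" for a b u h
    using mono2_times_cnj[OF l, of a b u] by (simp flip: mult.assoc)
  have comm: "(a(i := Suc (a i)))(l := Suc ((a(i := Suc (a i))) l))
      = (a(l := Suc (a l)))(i := Suc ((a(l := Suc (a l))) i))" for a :: "nat \<Rightarrow> nat"
    by auto
  then show ?thesis
    using g unfolding stein_def * comm by blast
qed

lemma stein_scale:
  assumes "stein d i g g'" shows "stein d i (\<lambda>u. c * g u) (\<lambda>u. c * g' u)"
proof -
  have *: "mono2 d a b u * (c * h) = c * (mono2 d a b u * h)" for a b u h by simp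
  show ?thesis
    using assms unfolding stein_def * by (simp add: algebra_simps)
qed

lemma stein_sum:
  assumes "\<And>l. l \<in> L \<Longrightarrow> stein d i (g l) (g' l)"
  shows "stein d i (\<lambda>u. \<Sum>l\<in>L. g l u) (\<lambda>u. \<Sum>l\<in>L. g' l u)"
  unfolding stein_def sum_distrib_left
  using steinD[OF assms] by (auto simp: sum.distrib sum_distrib_left intro!: integrable_sum)

section \<open>Moments of the pairing with a Gaussian vector\<close>

definition pairing :: "nat \<Rightarrow> (nat \<Rightarrow> complex) \<Rightarrow> (nat \<Rightarrow> complex) \<Rightarrow> complex" where
  "pairing d x u = (\<Sum>l<d. x l * cnj (u l))"

text \<open>The pairing is antilinear in \<open>u\<close>, so it passes through the derivative as a
  constant. Only its conjugate is differentiated, with derivative \<open>cnj (x i)\<close>.\<close>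

lemma stein_pairing:
  assumes "stein d i g g'"
  shows "stein d i (\<lambda>u. pairing d x u * g u) (\<lambda>u. pairing d x u * g' u)"
proof -
  have "stein d i (\<lambda>u. x l * (cnj (u l) * g u)) (\<lambda>u. x l * (cnj (u l) * g' u))" if "l \<in> {..<d}" for l
    using that by (intro stein_scale stein_cnj assms) simp
  from stein_sum[of "{..<d}", OF this] show ?thesis
    by (simp add: pairing_def sum_distrib_right mult.assoc)
qed

lemma stein_cnj_pairing:
  assumes "stein d i g g'" "i < d"
  shows "stein d i (\<lambda>u. cnj (pairing d x u) * g u) (\<lambda>u. cnj (x i) * g u + cnj (pairing d x u) * g' u)"
proof -
  have "cnj (x i) * g u = (\<Sum>l<d. cnj (x l) * (of_bool (l = i) * g u))" for u
    using assms(2) by (subst sum.remove[of _ i]) auto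
  moreover have "stein d i (\<lambda>u. cnj (x l) * (u l * g u))
      (\<lambda>u. cnj (x l) * (of_bool (l = i) * g u + u l * g' u))" if "l \<in> {..<d}" for l
    using that by (intro stein_scale stein_var assms) simp
  note stein_sum[of "{..<d}", OF this]
  ultimately show ?thesis
    by (simp add: pairing_def sum_distrib_right mult.assoc sum.distrib distrib_left)
qed

lemma stein_pairing_powers:
  assumes "i < d"
  shows "stein d i (\<lambda>u. pairing d x u ^ a * cnj (pairing d x u) ^ b)
     (\<lambda>u. of_nat b * cnj (x i) * (pairing d x u ^ a * cnj (pairing d x u) ^ (b - 1)))"
proof (induction a)
  case 0
  show ?case
  proof (induction b)
    case 0
    show ?case using stein_one[OF assms] by simp
  next
    case (Suc b)
    have "cnj (x i) * cnj (pairing d x u) ^ b + cnj (pairing d x u) * (of_nat b * cnj (x i) * cnj (pairing d x u) ^ (b - 1))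
       = of_nat (Suc b) * cnj (x i) * cnj (pairing d x u) ^ b" for u
      by (cases b) (simp_all add: algebra_simps)
    then show ?case using stein_cnj_pairing[OF Suc assms, of x] by simp
  qed
next
  case (Suc a)
  from stein_pairing[OF Suc, of x] show ?case by (simp add: mult_ac)
qed

text \<open>The usable form of \<open>stein\<close>, obtained with the trivial monomial
  \<open>a = b = 0\<close>.\<close>

lemma stein_integral:
  assumes "stein d i g g'" "i < d"
  shows "integrable (gvec d) (\<lambda>u. cnj (u i) * g u)" "integrable (gvec d) g"
    "(\<integral>u. cnj (u i) * g u \<partial>gvec d) = (\<integral>u. g' u \<partial>gvec d)"
proof -
  have 1: "mono2 d (\<lambda>_. 0) (\<lambda>_. 0) u = 1" for u by (simp add: mono2_def)
  have 2: "mono2 d ((\<lambda>_. 0)(i := Suc 0)) (\<lambda>_. 0) u = cnj (u i)" for u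
    using mono2_times_cnj[OF assms(2), of "\<lambda>_. 0" "\<lambda>_. 0" u] by (simp add: 1)
  show "integrable (gvec d) (\<lambda>u. cnj (u i) * g u)"
    using steinD(1)[OF assms(1), of "(\<lambda>_. 0)(i := Suc 0)" "\<lambda>_. 0"] by (simp add: 2)
  show "integrable (gvec d) g"
    using steinD(1)[OF assms(1), of "\<lambda>_. 0" "\<lambda>_. 0"] by (simp add: 1)
  show "(\<integral>u. cnj (u i) * g u \<partial>gvec d) = (\<integral>u. g' u \<partial>gvec d)"
    using steinD(3)[OF assms(1), of "\<lambda>_. 0" "\<lambda>_. 0"] by (simp add: 1 2)
qed

lemma pairing_moment_shift:
  assumes "i < d"
  shows "(\<integral>u. cnj (u i) * (pairing d x u ^ a * cnj (pairing d x u) ^ Suc a) \<partial>gvec d)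
     = of_nat (Suc a) * cnj (x i) * (\<integral>u. pairing d x u ^ a * cnj (pairing d x u) ^ a \<partial>gvec d)"
  using stein_integral(3)[OF stein_pairing_powers[OF assms, of x a "Suc a"] assms] by simp

text \<open>Expanding one factor of the pairing exposes some \<open>cnj (u l)\<close>. Integration
  by parts trades it for \<open>(N + 1) cnj (x l)\<close>, and summing over \<open>l\<close> yields
  one more factor \<open>|x|^2\<close>.\<close>

lemma pairing_moment:
  "(\<integral>u. pairing d x u ^ N * cnj (pairing d x u) ^ N \<partial>gvec d)
     = fact N * of_real (\<Sum>l<d. (cmod (x l))\<^sup>2) ^ N"
proof (induction N)
  case 0
  then show ?case by (simp add: prob_space.prob_space prob_space_gvec)
next
  case (Suc N)
  have "pairing d x u ^ Suc N * cnj (pairing d x u) ^ Suc N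
     = (\<Sum>l<d. x l * (cnj (u l) * (pairing d x u ^ N * cnj (pairing d x u) ^ Suc N)))" for u
    by (simp add: pairing_def sum_distrib_right mult.assoc)
  moreover have "integrable (gvec d) (\<lambda>u. x l * (cnj (u l) * (pairing d x u ^ N * cnj (pairing d x u) ^ Suc N)))" if "l < d" for l
    using stein_integral(1)[OF stein_pairing_powers[OF that] that] by (rule integrable_mult_right)
  ultimately have "(\<integral>u. pairing d x u ^ Suc N * cnj (pairing d x u) ^ Suc N \<partial>gvec d)
     = (\<Sum>l<d. x l * (of_nat (Suc N) * cnj (x l) * (fact N * of_real (\<Sum>l<d. (cmod (x l))\<^sup>2) ^ N)))"
    using pairing_moment_shift[of _ d x N] Suc.IH by (simp add: Bochner_Integration.integral_sum)
  also have "\<dots> = fact (Suc N) * (\<Sum>l<d. x l * cnj (x l)) * of_real (\<Sum>l<d. (cmod (x l))\<^sup>2) ^ N"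
    unfolding sum_distrib_left sum_distrib_right by (simp add: mult_ac)
  also have "(\<Sum>l<d. x l * cnj (x l)) = of_real (\<Sum>l<d. (cmod (x l))\<^sup>2)"
    unfolding of_real_sum complex_norm_square ..
  also have "fact (Suc N) * \<dots> * of_real (\<Sum>l<d. (cmod (x l))\<^sup>2) ^ N = fact (Suc N) * of_real (\<Sum>l<d. (cmod (x l))\<^sup>2) ^ Suc N"
    by (simp only: power_Suc mult.assoc)
  finally show ?case .
qed

text \<open>Integration by parts removes \<open>cnj (u i)\<close>. The derivative falls either on
  \<open>u j\<close>, which gives the Kronecker term, or on a factor
  \<open>cnj (pairing d x u)\<close>, which leaves an integral with the single coordinate
  \<open>u j\<close>.\<close>

lemma block_moment:
  assumes "i < d" "j < d" "N > 0"
  shows "has_bochner_integral (gvec d)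
     (\<lambda>u. cnj (u i) * u j * (pairing d x u ^ N * cnj (pairing d x u) ^ N))
     (fact N * (of_nat N * of_real (\<Sum>l<d. (cmod (x l))\<^sup>2) ^ (N - 1) * (cnj (x i) * x j)
        + of_bool (i = j) * of_real (\<Sum>l<d. (cmod (x l))\<^sup>2) ^ N))"
proof -
  define s where "s u = pairing d x u" for u
  define q :: complex where "q = of_real (\<Sum>l<d. (cmod (x l))\<^sup>2)"
  obtain K where N: "N = Suc K" using assms(3) by (cases N) auto
  note st = stein_var[OF stein_pairing_powers[OF assms(1), of x N N] assms(2), folded s_def]
  have int0: "integrable (gvec d) (\<lambda>u. s u ^ N * cnj (s u) ^ N)"
    using stein_integral(2)[OF stein_pairing_powers[OF assms(1)] assms(1)] by (simp add: s_def)
  have int1: "integrable (gvec d) (\<lambda>u. u j * (s u ^ N * cnj (s u) ^ K))"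
    using stein_integral(2)[OF stein_var[OF stein_pairing_powers[OF assms(1)] assms(2)] assms(1), of x N K]
    by (simp add: s_def)
  \<comment> \<open>Conjugation turns \<open>u j\<close> into \<open>cnj (u j)\<close>, so that a
    second integration by parts applies.\<close>
  have "(\<integral>u. u j * (s u ^ N * cnj (s u) ^ K) \<partial>gvec d) = cnj (\<integral>u. cnj (u j) * (s u ^ K * cnj (s u) ^ N) \<partial>gvec d)"
    unfolding Bochner_Integration.integral_cnj[symmetric] by (simp add: mult_ac)
  also have "\<dots> = of_nat N * x j * (fact K * q ^ K)"
    using pairing_moment_shift[OF assms(2), of x K] pairing_moment[of d x K]
    by (simp add: N s_def q_def)
  finally have 1: "(\<integral>u. u j * (s u ^ N * cnj (s u) ^ K) \<partial>gvec d) = of_nat N * x j * (fact K * q ^ K)" .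
  have "(\<integral>u. cnj (u i) * (u j * (s u ^ N * cnj (s u) ^ N)) \<partial>gvec d)
     = (\<integral>u. of_bool (j = i) * (s u ^ N * cnj (s u) ^ N)
          + of_nat N * cnj (x i) * (u j * (s u ^ N * cnj (s u) ^ K)) \<partial>gvec d)"
    using stein_integral(3)[OF st assms(1)] by (simp add: N mult_ac)
  also have "\<dots> = of_bool (j = i) * (fact N * q ^ N) + of_nat N * cnj (x i) * (of_nat N * x j * (fact K * q ^ K))"
    by (subst Bochner_Integration.integral_add)
      (use int0 int1 1 pairing_moment[of d x N] in \<open>auto simp: s_def q_def\<close>)
  also have "\<dots> = fact N * (of_nat N * q ^ (N - 1) * (cnj (x i) * x j) + of_bool (i = j) * q ^ N)"
    by (auto simp: N algebra_simps)
  finally show ?thesis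
    using stein_integral(1)[OF st assms(1)]
    by (simp add: has_bochner_integral_iff s_def q_def mult.assoc)
qed

subsection \<open>Positive definite forms and the psd cone\<close>

lemma finite_midx: "finite (midx m n)"
  unfolding midx_def by (intro finite_PiE) auto

lemma midxD: "I \<in> midx m n \<Longrightarrow> k < m \<Longrightarrow> I k < n k"
  by (auto simp: midx_def)

lemma blocknorm2_nonneg: "blocknorm2 n x k \<ge> 0"
  by (simp add: blocknorm2_def sum_nonneg)

lemma blocknorm2_eq_0_iff: "blocknorm2 n x k = 0 \<longleftrightarrow> (\<forall>j<n k. x k j = 0)"
  by (auto simp: blocknorm2_def sum_nonneg_eq_0_iff)

lemma hform_zero_block:
  assumes "k < m" "blocknorm2 n x k = 0"
  shows "hform m n H x = 0"
proof -
  have "(\<Prod>k<m. x k (J k)) = 0" if "J \<in> midx m n" for J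
    using assms midxD[OF that assms(1)] by (auto simp: blocknorm2_eq_0_iff)
  then show ?thesis unfolding hform_def by (intro sum.neutral ballI) (simp only: mult_zero_right)
qed

lemma hform_scale:
  "hform m n H (\<lambda>k j. of_real (c k) * y k j) = of_real (\<Prod>k<m. (c k)\<^sup>2) * hform m n H y"
  by (simp add: hform_def prod.distrib sum_distrib_left power2_eq_square mult_ac)

lemma cmod_prod_coord_le:
  assumes "I \<in> midx m n"
  shows "cmod (\<Prod>k<m. x k (I k)) \<le> sqrt (\<Prod>k<m. blocknorm2 n x k)"
proof -
  have "cmod (x k (I k)) \<le> sqrt (blocknorm2 n x k)" if "k < m" for k
    using midxD[OF assms that] unfolding blocknorm2_def
    by (intro real_le_rsqrt member_le_sum) auto
  then have "(\<Prod>k<m. cmod (x k (I k))) \<le> (\<Prod>k<m. sqrt (blocknorm2 n x k))"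
    by (intro prod_mono) auto
  also have "\<dots> = sqrt (\<Prod>k<m. blocknorm2 n x k)"
    by (induction m) (auto simp: real_sqrt_mult)
  finally show ?thesis by (simp add: prod_norm)
qed

text \<open>Each product of coordinates is at most the square root of the product of the block
  norms. The bound has the same degree as the one in \<open>C_pd_lower_bound\<close>, so entrywise
  closeness to a positive definite tensor gives nonnegativity for all \<open>x\<close> at
  once.\<close>

lemma hform_diff_bound:
  "cmod (hform m n F x - hform m n H x)
     \<le> (\<Sum>I\<in>midx m n. \<Sum>J\<in>midx m n. cmod (F I J - H I J)) * (\<Prod>k<m. blocknorm2 n x k)"
proof -
  define P where "P = (\<Prod>k<m. blocknorm2 n x k)"
  define X where "X I = (\<Prod>k<m. x k (I k))" for I
  have P: "P \<ge> 0" unfolding P_def by (intro prod_nonneg) (auto simp: blocknorm2_nonneg)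
  have X: "cmod (X I) \<le> sqrt P" if "I \<in> midx m n" for I
    using cmod_prod_coord_le[OF that] by (simp add: X_def P_def)
  have "hform m n F x - hform m n H x = (\<Sum>I\<in>midx m n. \<Sum>J\<in>midx m n.
       (F I J - H I J) * (cnj (X I) * X J))"
    unfolding hform_def sum_subtractf[symmetric] X_def
    by (intro sum.cong refl) (simp only: left_diff_distrib mult.assoc)
  also have "cmod \<dots> \<le> (\<Sum>I\<in>midx m n. \<Sum>J\<in>midx m n. cmod (F I J - H I J) * P)"
  proof (intro sum_norm_le)
    fix I J assume IJ: "I \<in> midx m n" "J \<in> midx m n"
    have "cmod (X I) * cmod (X J) \<le> sqrt P * sqrt P"
      using P by (intro mult_mono X IJ) auto
    then have "cmod (X I) * cmod (X J) \<le> P" using P by simp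
    then show "cmod ((F I J - H I J) * (cnj (X I) * X J)) \<le> cmod (F I J - H I J) * P"
      unfolding norm_mult complex_mod_cnj by (rule mult_left_mono) simp
  qed
  finally show ?thesis by (simp add: sum_distrib_right P_def)
qed

section \<open>Compactness of the product of spheres and a uniform lower bound\<close>

lemma compact_PiE_UNIV:
  fixes S :: "'i \<Rightarrow> 'b :: topological_space set"
  assumes "\<And>i. compact (S i)"
  shows "compact (PiE UNIV S)"
proof -
  have "compactin (product_topology (\<lambda>i. euclidean) UNIV) (PiE UNIV S)"
    using assms by (subst compactin_PiE) auto
  then show ?thesis by (simp add: euclidean_product_topology)
qed

lemma continuous_on_coord2 [continuous_intros]:
  "continuous_on S (\<lambda>x :: nat \<Rightarrow> nat \<Rightarrow> complex. x k j)"
proof -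
  have "continuous_on UNIV (\<lambda>x :: nat \<Rightarrow> nat \<Rightarrow> complex. x k j)"
    by (rule continuous_on_product_then_coordinatewise) simp
  then show ?thesis by (rule continuous_on_subset) simp
qed

text \<open>The form attains a positive minimum on the product of unit spheres, and homogeneity in
  each block extends the bound to all points with nonzero blocks. If some block vanishes, both sides
  are 0.\<close>

lemma C_pd_lower_bound:
  assumes "C_pd m n H"
  obtains c where "c > 0" "\<And>x. Re (hform m n H x) \<ge> c * (\<Prod>k<m. blocknorm2 n x k)"
proof -
  \<comment> \<open>Coordinates outside the dimensions are fixed to 0; otherwise the set would not
    be compact in the full function space.\<close>
  define K where "K = PiE UNIV (\<lambda>k. PiE UNIV (\<lambda>j. if k < m \<and> j < n k then cball (0::complex) 1 else {0}))
     \<inter> {x. \<forall>k<m. blocknorm2 n x k = 1}"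
  have "continuous_on UNIV (\<lambda>x. blocknorm2 n x k)" for k
    unfolding blocknorm2_def by (intro continuous_intros)
  then have "closed (\<Inter>k\<in>{..<m}. {x. blocknorm2 n x k = 1})"
    by (intro closed_INT ballI closed_Collect_eq continuous_on_const)
  also have "(\<Inter>k\<in>{..<m}. {x. blocknorm2 n x k = 1}) = {x. \<forall>k<m. blocknorm2 n x k = 1}"
    by auto
  finally have "closed {x. \<forall>k<m. blocknorm2 n x k = 1}" .
  then have K: "compact K"
    unfolding K_def by (intro compact_Int_closed compact_PiE_UNIV) auto
  have cont: "continuous_on K (\<lambda>x. Re (hform m n H x))"
    unfolding hform_def by (intro continuous_intros)
  obtain c where c: "c > 0" "\<And>x. x \<in> K \<Longrightarrow> c \<le> Re (hform m n H x)"
  proof (cases "K = {}")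
    case True
    \<comment> \<open>\<open>K\<close> is empty when some block has dimension 0; the bound on
      \<open>K\<close> is then vacuous.\<close>
    then show ?thesis using that[of 1] by auto
  next
    case False
    obtain z where z: "z \<in> K" "\<And>x. x \<in> K \<Longrightarrow> Re (hform m n H z) \<le> Re (hform m n H x)"
      using continuous_attains_inf[OF K False cont] by auto
    have "\<exists>j<n k. z k j \<noteq> 0" if "k < m" for k
    proof -
      have "blocknorm2 n z k \<noteq> 0" using z(1) that by (auto simp: K_def)
      then show ?thesis by (auto simp: blocknorm2_eq_0_iff)
    qed
    then have "Re (hform m n H z) > 0"
      using assms by (auto simp: C_pd_def)
    then show ?thesis using that z(2) by blast
  qed
  have "Re (hform m n H x) \<ge> c * (\<Prod>k<m. blocknorm2 n x k)" for x
  proof (cases "\<exists>k<m. blocknorm2 n x k = 0")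
    case True
    then obtain k where k: "k < m" "blocknorm2 n x k = 0" by blast
    then have 0: "(\<Prod>k<m. blocknorm2 n x k) = 0" by (intro prod_zero bexI[of _ k]) auto
    show ?thesis unfolding 0 hform_zero_block[OF k] by simp
  next
    case False
    define q where "q k = sqrt (blocknorm2 n x k)" for k
    have q: "q k > 0" if "k < m" for k
    proof -
      have "blocknorm2 n x k \<noteq> 0" using False that by blast
      then show ?thesis using blocknorm2_nonneg[of n x k] unfolding q_def by simp
    qed
    \<comment> \<open>Each block is normalised, and irrelevant coordinates are set to 0 so that
      \<open>y\<close> lies in \<open>K\<close>.\<close>
    define y where "y k j = (if k < m \<and> j < n k then x k j / of_real (q k) else 0)" for k j
    have y1: "blocknorm2 n y k = 1" if "k < m" for k
    proof -
      have "blocknorm2 n y k = blocknorm2 n x k / (q k)\<^sup>2"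
        using that q[OF that]
        by (simp add: blocknorm2_def y_def norm_divide power_divide sum_divide_distrib)
      then show ?thesis using q[OF that] blocknorm2_nonneg[of n x k] by (simp add: q_def)
    qed
    have "cmod (y k j) \<le> 1" if "k < m" "j < n k" for k j
    proof -
      have "(cmod (y k j))\<^sup>2 \<le> blocknorm2 n y k"
        unfolding blocknorm2_def using that by (intro member_le_sum) auto
      then show ?thesis using y1[OF that(1)] by (simp add: abs_square_le_1)
    qed
    then have "y \<in> K" using y1 by (auto simp: K_def y_def)
    have "hform m n H x = hform m n H (\<lambda>k j. of_real (q k) * y k j)"
    proof -
      have "(\<Prod>k<m. x k (I k)) = (\<Prod>k<m. of_real (q k) * y k (I k))" if "I \<in> midx m n" for I
        using q midxD[OF that] by (intro prod.cong) (auto simp: y_def less_imp_neq[symmetric])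
      then show ?thesis unfolding hform_def by (intro sum.cong) auto
    qed
    then have "hform m n H x = of_real (\<Prod>k<m. (q k)\<^sup>2) * hform m n H y"
      by (simp only: hform_scale)
    moreover have "(\<Prod>k<m. (q k)\<^sup>2) = (\<Prod>k<m. blocknorm2 n x k)"
      by (simp add: q_def blocknorm2_nonneg)
    ultimately have "Re (hform m n H x) = (\<Prod>k<m. blocknorm2 n x k) * Re (hform m n H y)"
      by (simp del: of_real_prod)
    also have "\<dots> \<ge> (\<Prod>k<m. blocknorm2 n x k) * c"
      by (intro mult_left_mono c(2) \<open>y \<in> K\<close> prod_nonneg) (auto simp: blocknorm2_nonneg)
    finally show ?thesis by (simp add: mult.commute)
  qed
  with c(1) show ?thesis using that by blast
qed

section \<open>Interior points of the psd cone and the easy inclusion\<close>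

lemma hform_delta:
  "hform m n (\<lambda>I J. of_bool (I = J)) x = of_real (\<Prod>k<m. blocknorm2 n x k)"
proof -
  have "hform m n (\<lambda>I J. of_bool (I = J)) x = (\<Sum>I\<in>midx m n. of_real ((cmod (\<Prod>k<m. x k (I k)))\<^sup>2))"
    unfolding hform_def
  proof (intro sum.cong refl)
    fix I assume I: "I \<in> midx m n"
    have "(\<Sum>J\<in>midx m n. of_bool (I = J) * cnj (\<Prod>k<m. x k (I k)) * (\<Prod>k<m. x k (J k)))
       = (\<Sum>J\<in>midx m n. if J = I then cnj (\<Prod>k<m. x k (I k)) * (\<Prod>k<m. x k (J k)) else 0)"
      by (intro sum.cong) auto
    then show "(\<Sum>J\<in>midx m n. of_bool (I = J) * cnj (\<Prod>k<m. x k (I k)) * (\<Prod>k<m. x k (J k)))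
       = of_real ((cmod (\<Prod>k<m. x k (I k)))\<^sup>2)"
      using I finite_midx unfolding complex_norm_square by (simp add: mult.commute)
  qed
  also have "\<dots> = of_real (\<Sum>I\<in>midx m n. \<Prod>k<m. (cmod (x k (I k)))\<^sup>2)"
    by (simp add: prod_norm[symmetric] prod_power_distrib)
  also have "\<dots> = of_real (\<Prod>k<m. blocknorm2 n x k)"
    unfolding blocknorm2_def midx_def by (subst prod_sum_PiE) auto
  finally show ?thesis .
qed

lemma C_pd_of_tinterior:
  assumes "H \<in> tinterior m n (psd_cone m n)"
  shows "C_pd m n H"
proof -
  obtain e where e: "e > 0" "\<And>G. herm_tensor m n G \<Longrightarrow> tdist m n H G < e \<Longrightarrow> C_psd m n G"
    and herm: "herm_tensor m n H"
    using assms by (auto simp: tinterior_def psd_cone_def)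
  \<comment> \<open>The norm of the identity tensor. Dividing \<open>e\<close> by
    \<open>N + 1\<close> keeps \<open>t N < e\<close> strict and also covers \<open>N = 0\<close>,
    which occurs when there are no multi-indices.\<close>
  define N where "N = sqrt (\<Sum>I\<in>midx m n. \<Sum>J\<in>midx m n. of_bool (I = J))"
  define t where "t = e / (N + 1)"
  have N: "N \<ge> 0" unfolding N_def by (auto intro!: sum_nonneg)
  have t: "t > 0" using e(1) N by (simp add: t_def)
  define G where "G I J = H I J - of_real t * of_bool (I = J)" for I J
  have "herm_tensor m n G"
    unfolding herm_tensor_def
  proof (intro ballI)
    fix I J assume "I \<in> midx m n" "J \<in> midx m n"
    then have h: "H I J = cnj (H J I)" using herm unfolding herm_tensor_def by blast
    show "G I J = cnj (G J I)" unfolding G_def by (subst h) (auto simp: of_bool_def)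
  qed
  moreover have "tdist m n H G < e"
  proof -
    have "(\<Sum>I\<in>midx m n. \<Sum>J\<in>midx m n. (cmod (H I J - G I J))\<^sup>2)
       = t\<^sup>2 * (\<Sum>I\<in>midx m n. \<Sum>J\<in>midx m n. of_bool (I = J))"
      unfolding sum_distrib_left by (intro sum.cong) (auto simp: G_def)
    then have "tdist m n H G = t * N"
      using t by (simp add: tdist_def N_def real_sqrt_mult)
    also have "\<dots> < e" using e(1) N by (simp add: t_def field_simps)
    finally show ?thesis .
  qed
  ultimately have psd: "C_psd m n G" by (rule e(2))
  have G: "hform m n G x = hform m n H x - of_real t * hform m n (\<lambda>I J. of_bool (I = J)) x" for x
    unfolding hform_def G_def sum_distrib_left sum_subtractf[symmetric]
    by (intro sum.cong refl) (simp only: left_diff_distrib mult.assoc)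
  have "Re (hform m n H x) > 0" if "\<forall>i<m. \<exists>j<n i. x i j \<noteq> 0" for x
  proof -
    have "blocknorm2 n x k > 0" if "k < m" for k
    proof -
      have "blocknorm2 n x k \<noteq> 0"
        using \<open>\<forall>i<m. _ i\<close> that by (auto simp: blocknorm2_eq_0_iff)
      then show ?thesis using blocknorm2_nonneg[of n x k] by linarith
    qed
    then have "t * (\<Prod>k<m. blocknorm2 n x k) > 0" using t by (intro mult_pos_pos prod_pos) auto
    moreover have "Re (hform m n G x) \<ge> 0" using psd by (simp add: C_psd_def)
    ultimately show ?thesis unfolding G hform_delta by (simp del: of_real_prod)
  qed
  then show ?thesis using herm by (simp add: C_pd_def)
qed

text \<open>Where no block vanishes, the multiplier is positive and can be divided out; elsewhere
  the form itself is 0.\<close>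

lemma Omega_C_subset_psd_cone: "Omega_C m n k \<subseteq> psd_cone m n"
proof
  fix H assume "H \<in> Omega_C m n k"
  then have herm: "herm_tensor m n H"
    and sos: "herm_sos m n (\<lambda>x. (\<Prod>i<m. blocknorm2 n x i ^ k i) * Re (hform m n H x))"
    by (auto simp: Omega_C_def)
  have "Re (hform m n H x) \<ge> 0" for x
  proof (cases "\<exists>i<m. blocknorm2 n x i = 0")
    case True
    then obtain i where i: "i < m" "blocknorm2 n x i = 0" by blast
    show ?thesis by (simp add: hform_zero_block[OF i])
  next
    case False
    have "blocknorm2 n x i > 0" if "i < m" for i
    proof -
      have "blocknorm2 n x i \<noteq> 0" using False that by blast
      then show ?thesis using blocknorm2_nonneg[of n x i] by linarith
    qed
    then have P: "(\<Prod>i<m. blocknorm2 n x i ^ k i) > 0" by (intro prod_pos) auto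
    have "(\<Prod>i<m. blocknorm2 n x i ^ k i) * Re (hform m n H x) \<ge> 0"
      using sos by (auto simp: herm_sos_def intro!: sum_nonneg)
    with P show ?thesis by (simp add: zero_le_mult_iff)
  qed
  then show "H \<in> psd_cone m n" using herm by (simp add: psd_cone_def C_psd_def)
qed

subsection \<open>Gaussian averages of Hermitian forms\<close>

definition gall :: "nat \<Rightarrow> (nat \<Rightarrow> nat) \<Rightarrow> (nat \<Rightarrow> nat \<Rightarrow> complex) measure" where
  "gall m n = PiM {..<m} (\<lambda>k. gvec (n k))"

lemma gall_product:
  fixes f :: "nat \<Rightarrow> (nat \<Rightarrow> complex) \<Rightarrow> complex"
  assumes "\<And>k. k < m \<Longrightarrow> has_bochner_integral (gvec (n k)) (f k) (c k)"
  shows "has_bochner_integral (gall m n) (\<lambda>u. \<Prod>k<m. f k (u k)) (\<Prod>k<m. c k)"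
proof -
  interpret product_sigma_finite "\<lambda>k. gvec (n k)"
    by (intro product_sigma_finite.intro prob_space_imp_sigma_finite prob_space_gvec)
  show ?thesis
    using assms product_integrable_prod[of "{..<m}" f] product_integral_prod[of "{..<m}" f]
    by (simp add: gall_def has_bochner_integral_iff)
qed

text \<open>By independence of the blocks, each entry of \<open>F\<close> contributes a product of
  the integrals in \<open>block_moment\<close>.\<close>

lemma hform_pairing_moment:
  assumes "N > 0"
  shows "has_bochner_integral (gall m n)
    (\<lambda>u. hform m n F u * (\<Prod>k<m. pairing (n k) (x k) (u k) ^ N * cnj (pairing (n k) (x k) (u k)) ^ N))
    (\<Sum>I\<in>midx m n. \<Sum>J\<in>midx m n. F I J * (\<Prod>k<m.
       fact N * (of_nat N * of_real (blocknorm2 n x k) ^ (N - 1) * (cnj (x k (I k)) * x k (J k))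
        + of_bool (I k = J k) * of_real (blocknorm2 n x k) ^ N)))"
proof -
  let ?s = "\<lambda>u k. pairing (n k) (x k) (u k) ^ N * cnj (pairing (n k) (x k) (u k)) ^ N"
  have "hform m n F u * (\<Prod>k<m. ?s u k)
    = (\<Sum>I\<in>midx m n. \<Sum>J\<in>midx m n. F I J * (\<Prod>k<m. cnj (u k (I k)) * u k (J k) * ?s u k))" for u
    unfolding hform_def sum_distrib_right prod.distrib cnj_prod by (simp only: mult.assoc)
  moreover have "has_bochner_integral (gall m n)
      (\<lambda>u. \<Prod>k<m. cnj (u k (I k)) * u k (J k) * ?s u k)
      (\<Prod>k<m. fact N * (of_nat N * of_real (blocknorm2 n x k) ^ (N - 1) * (cnj (x k (I k)) * x k (J k))
        + of_bool (I k = J k) * of_real (blocknorm2 n x k) ^ N))"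
    if "I \<in> midx m n" "J \<in> midx m n" for I J
    unfolding blocknorm2_def using that
    by (intro gall_product[where f = "\<lambda>k v. cnj (v (I k)) * v (J k) *
        (pairing (n k) (x k) v ^ N * cnj (pairing (n k) (x k) v) ^ N)"] block_moment assms midxD[of _ m n])
  ultimately show ?thesis
    by (simp only:) (intro has_bochner_integral_sum has_bochner_integral_mult_right; assumption | simp only:)
qed

text \<open>A word picks a coordinate for each of the \<open>N\<close> factors of each block; distinct words may give
  the same monomial.\<close>

definition words :: "nat \<Rightarrow> (nat \<Rightarrow> nat) \<Rightarrow> nat \<Rightarrow> (nat \<times> nat \<Rightarrow> nat) set" where
  "words m n N = PiE ({..<m} \<times> {..<N}) (\<lambda>(k, p). {..<n k})"

definition word_monom :: "nat \<Rightarrow> nat \<Rightarrow> (nat \<times> nat \<Rightarrow> nat) \<Rightarrow> (nat \<Rightarrow> nat \<Rightarrow> complex) \<Rightarrow> complex" where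
  "word_monom m N w x = (\<Prod>k<m. \<Prod>p<N. x k (w (k, p)))"

lemma finite_words: "finite (words m n N)"
  unfolding words_def by (intro finite_PiE) auto

lemma wordsD: "w \<in> words m n N \<Longrightarrow> k < m \<Longrightarrow> p < N \<Longrightarrow> w (k, p) < n k"
  by (auto simp: words_def PiE_iff)

text \<open>Distributivity separates \<open>x\<close> from \<open>u\<close>. Summing over words
  instead of exponents avoids multinomial coefficients.\<close>

lemma prod_pairing_words:
  "(\<Prod>k<m. pairing (n k) (x k) (u k) ^ N)
     = (\<Sum>w\<in>words m n N. word_monom m N w x * cnj (word_monom m N w u))"
proof -
  have "(\<Prod>k<m. pairing (n k) (x k) (u k) ^ N) = (\<Prod>k<m. \<Prod>p<N. pairing (n k) (x k) (u k))"
    by simp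
  also have "\<dots> = (\<Prod>z\<in>{..<m} \<times> {..<N}. \<Sum>l\<in>(case z of (k, p) \<Rightarrow> {..<n k}). x (fst z) l * cnj (u (fst z) l))"
    unfolding prod.cartesian_product by (intro prod.cong refl) (auto simp: pairing_def)
  also have "\<dots> = (\<Sum>w\<in>words m n N. \<Prod>z\<in>{..<m} \<times> {..<N}. x (fst z) (w z) * cnj (u (fst z) (w z)))"
    unfolding words_def by (subst prod_sum_PiE) auto
  also have "\<dots> = (\<Sum>w\<in>words m n N. word_monom m N w x * cnj (word_monom m N w u))"
  proof (intro sum.cong refl)
    fix w
    have "(\<Prod>z\<in>{..<m} \<times> {..<N}. x (fst z) (w z) * cnj (u (fst z) (w z)))
       = (\<Prod>k<m. \<Prod>p<N. x k (w (k, p)) * cnj (u k (w (k, p))))"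
      by (simp add: prod.cartesian_product case_prod_beta)
    then show "(\<Prod>z\<in>{..<m} \<times> {..<N}. x (fst z) (w z) * cnj (u (fst z) (w z)))
       = word_monom m N w x * cnj (word_monom m N w u)"
      by (simp add: word_monom_def prod.distrib)
  qed
  finally show ?thesis .
qed

text \<open>In \<open>is_cpoly\<close> the coefficient depends on the exponent alone, so terms whose
  exponents \<open>\<alpha> s\<close> coincide are merged.\<close>

lemma is_cpoly_sum_cmonom:
  assumes "finite S"
  shows "is_cpoly m n (\<lambda>x. \<Sum>s\<in>S. c s * cmonom m n (\<alpha> s) x)"
  unfolding is_cpoly_def
proof (intro exI conjI allI)
  show "finite (\<alpha> ` S)" using assms by simp
  fix x
  show "(\<Sum>s\<in>S. c s * cmonom m n (\<alpha> s) x)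
     = (\<Sum>a\<in>\<alpha> ` S. (\<Sum>s\<in>{s\<in>S. \<alpha> s = a}. c s) * cmonom m n a x)"
    unfolding sum_distrib_right by (subst sum.image_gen[OF assms, of _ \<alpha>]) (auto intro!: sum.cong)
qed

lemma word_monom_eq_cmonom:
  assumes "w \<in> words m n N"
  shows "word_monom m N w x = cmonom m n (\<lambda>k j. card {p\<in>{..<N}. w (k, p) = j}) x"
  unfolding word_monom_def cmonom_def
proof (rule prod.cong[OF refl])
  fix k assume k: "k \<in> {..<m}"
  have "(\<Prod>j<n k. \<Prod>p\<in>{p\<in>{..<N}. w (k, p) = j}. x k (w (k, p))) = (\<Prod>p<N. x k (w (k, p)))"
    using k wordsD[OF assms] by (intro prod.group) auto
  moreover have "(\<Prod>p\<in>{p\<in>{..<N}. w (k, p) = j}. x k (w (k, p))) = x k j ^ card {p\<in>{..<N}. w (k, p) = j}" for j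
    by simp
  ultimately show "(\<Prod>p<N. x k (w (k, p))) = (\<Prod>j<n k. x k j ^ card {p\<in>{..<N}. w (k, p) = j})"
    by simp
qed

text \<open>Serves to obtain integrability through \<open>stein_integral\<close>, so the derivative
  is left unspecified.\<close>

lemma stein_word:
  assumes "i < d" "\<And>p. p < N \<Longrightarrow> w p < d" "\<And>p. p < N \<Longrightarrow> v p < d"
  shows "\<exists>g'. stein d i (\<lambda>u. \<Prod>p<N::nat. cnj (u (w p)) * u (v p)) g'"
  using assms
proof (induction N)
  case 0
  then show ?case using stein_one by auto
next
  case (Suc N)
  then obtain g' where "stein d i (\<lambda>u. \<Prod>p<N. cnj (u (w p)) * u (v p)) g'" by auto
  from stein_cnj[OF stein_var[OF this], of "v N" "w N"] Suc.prems
  show ?case by (auto simp: mult_ac)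
qed

lemma integrable_hform_words:
  assumes w: "w \<in> words m n N" and v: "v \<in> words m n N"
  shows "integrable (gall m n) (\<lambda>u. hform m n F u * (cnj (word_monom m N w u) * word_monom m N v u))"
proof -
  have eq: "hform m n F u * (cnj (word_monom m N w u) * word_monom m N v u)
    = (\<Sum>I\<in>midx m n. \<Sum>J\<in>midx m n. F I J * (\<Prod>k<m. cnj (u k (I k)) *
         (u k (J k) * (\<Prod>p<N. cnj (u k (w (k, p))) * u k (v (k, p))))))" for u
    unfolding hform_def word_monom_def sum_distrib_right prod.distrib cnj_prod by (simp only: mult.assoc)
  have "integrable (gall m n) (\<lambda>u. \<Prod>k<m. cnj (u k (I k)) *
         (u k (J k) * (\<Prod>p<N. cnj (u k (w (k, p))) * u k (v (k, p)))))"
    if IJ: "I \<in> midx m n" "J \<in> midx m n" for I J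
  proof -
    have "integrable (gvec (n k)) (\<lambda>u. cnj (u (I k)) * (u (J k) * (\<Prod>p<N. cnj (u (w (k, p))) * u (v (k, p)))))"
      if k: "k < m" for k
    proof -
      note Ik = midxD[OF IJ(1) k] and Jk = midxD[OF IJ(2) k]
      obtain g' where "stein (n k) (I k) (\<lambda>u. \<Prod>p<N. cnj (u (w (k, p))) * u (v (k, p))) g'"
        using stein_word[of "I k" "n k" N "\<lambda>p. w (k, p)" "\<lambda>p. v (k, p)", OF Ik wordsD[OF w k] wordsD[OF v k]] by blast
      from stein_integral(1)[OF stein_var[OF this Jk] Ik] show ?thesis .
    qed
    then have "has_bochner_integral (gvec (n k))
        (\<lambda>u. cnj (u (I k)) * (u (J k) * (\<Prod>p<N. cnj (u (w (k, p))) * u (v (k, p)))))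
        (\<integral>u. cnj (u (I k)) * (u (J k) * (\<Prod>p<N. cnj (u (w (k, p))) * u (v (k, p)))) \<partial>gvec (n k))"
      if "k < m" for k using that by (simp add: has_bochner_integral_iff)
    from gall_product[OF this] show ?thesis by (simp add: has_bochner_integral_iff)
  qed
  then show ?thesis
    unfolding eq by (intro Bochner_Integration.integrable_sum integrable_mult_right)
qed

lemma cnj_hform:
  assumes "herm_tensor m n F" shows "cnj (hform m n F x) = hform m n F x"
proof -
  have H: "F I J = cnj (F J I)" if "I \<in> midx m n" "J \<in> midx m n" for I J
    using assms that unfolding herm_tensor_def by blast
  have "cnj (hform m n F x) = (\<Sum>I\<in>midx m n. \<Sum>J\<in>midx m n.
       cnj (F I J) * (\<Prod>k<m. x k (I k)) * cnj (\<Prod>k<m. x k (J k)))"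
    by (simp add: hform_def)
  also have "\<dots> = (\<Sum>I\<in>midx m n. \<Sum>J\<in>midx m n.
       F J I * cnj (\<Prod>k<m. x k (J k)) * (\<Prod>k<m. x k (I k)))"
    by (intro sum.cong refl) (simp add: H[symmetric] mult_ac)
  also have "\<dots> = hform m n F x"
    unfolding hform_def by (rule sum.swap)
  finally show ?thesis .
qed

text \<open>The average is a quadratic form in the word monomials of \<open>x\<close>. With these
  replaced by arbitrary numbers \<open>y w\<close> it is still the integral of \<open>F\<close>
  times a squared modulus, hence nonnegative. So the matrix is psd, and its squares are squared
  moduli of polynomials in \<open>x\<close>.\<close>

lemma herm_sos_gaussian_average:
  assumes herm: "herm_tensor m n F" and nonneg: "\<And>u. Re (hform m n F u) \<ge> 0" and C: "C > 0"
  shows "herm_sos m n (\<lambda>x. Re (\<integral>u. hform m n F u *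
     (\<Prod>k<m. pairing (n k) (x k) (u k) ^ N * cnj (pairing (n k) (x k) (u k)) ^ N) \<partial>gall m n) / C)"
proof -
  define X where "X = word_monom m N"
  define W where "W = words m n N"
  have fin: "finite W" by (simp add: W_def finite_words)
  define M where "M v w = (\<integral>u. hform m n F u * (cnj (X w u) * X v u) \<partial>gall m n) / of_real C" for v w
  have int: "integrable (gall m n) (\<lambda>u. hform m n F u * (cnj (X w u) * X v u))" if "w \<in> W" "v \<in> W" for w v
    using that unfolding W_def X_def by (rule integrable_hform_words)
  have expand: "hform m n F u * ((\<Sum>w\<in>W. y w * cnj (X w u)) * cnj (\<Sum>w\<in>W. y w * cnj (X w u)))
     = (\<Sum>v\<in>W. \<Sum>w\<in>W. cnj (y v) * y w * (hform m n F u * (cnj (X w u) * X v u)))" for y u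
    unfolding cnj_sum sum_product unfolding sum_distrib_left
    by (rule trans[OF sum.swap]) (simp add: mult_ac)
  have int2: "integrable (gall m n) (\<lambda>u. hform m n F u * ((\<Sum>w\<in>W. y w * cnj (X w u)) * cnj (\<Sum>w\<in>W. y w * cnj (X w u))))" for y
    unfolding expand by (intro Bochner_Integration.integrable_sum integrable_mult_right int)
  have quad: "(\<Sum>v\<in>W. \<Sum>w\<in>W. M v w * cnj (y v) * y w)
     = (\<integral>u. hform m n F u * ((\<Sum>w\<in>W. y w * cnj (X w u)) * cnj (\<Sum>w\<in>W. y w * cnj (X w u))) \<partial>gall m n) / of_real C" for y
  proof -
    have "(\<integral>u. hform m n F u * ((\<Sum>w\<in>W. y w * cnj (X w u)) * cnj (\<Sum>w\<in>W. y w * cnj (X w u))) \<partial>gall m n)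
       = (\<Sum>v\<in>W. \<Sum>w\<in>W. cnj (y v) * y w * (\<integral>u. hform m n F u * (cnj (X w u) * X v u) \<partial>gall m n))"
      unfolding expand using int
      by (subst Bochner_Integration.integral_sum Bochner_Integration.integral_mult_right_zero;
          auto intro!: Bochner_Integration.integrable_sum integrable_mult_right sum.cong simp: Bochner_Integration.integral_sum)
    then show ?thesis
      by (simp add: M_def sum_divide_distrib mult_ac)
  qed
  have Mherm: "M v w = cnj (M w v)" for v w
    unfolding M_def complex_cnj_divide Bochner_Integration.integral_cnj[symmetric]
    by (simp add: cnj_hform[OF herm] mult_ac)
  have Mpsd: "Re (\<Sum>v\<in>W. \<Sum>w\<in>W. M v w * cnj (y v) * y w) \<ge> 0" for y
  proof -
    have "Re (hform m n F u * (z * cnj z)) = Re (hform m n F u) * (cmod z)\<^sup>2" for u z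
      unfolding complex_norm_square[symmetric] by simp
    then have "(\<integral>u. Re (hform m n F u * ((\<Sum>w\<in>W. y w * cnj (X w u)) * cnj (\<Sum>w\<in>W. y w * cnj (X w u)))) \<partial>gall m n) \<ge> 0"
      by (intro integral_nonneg_AE AE_I2) (simp only:, intro mult_nonneg_nonneg nonneg, simp)
    then show ?thesis
      unfolding quad using C integral_Re[OF int2] by simp
  qed
  obtain L :: nat and c where c: "\<And>y. (\<Sum>v\<in>W. \<Sum>w\<in>W. M v w * cnj (y v) * y w)
           = of_real (\<Sum>l<L. (cmod (\<Sum>a\<in>W. c l a * y a))\<^sup>2)"
    using psd_matrix_sos[of W M, OF fin Mherm Mpsd] by blast
  show ?thesis
    unfolding herm_sos_def
  \<comment> \<open>The linear forms of the decomposition, evaluated at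
    \<open>y w = X w x\<close>.\<close>
  proof (intro exI[of _ L] exI[of _ "\<lambda>l x. \<Sum>a\<in>W. c l a * X a x"] conjI allI impI)
    fix l
    have "(\<lambda>x. \<Sum>a\<in>W. c l a * X a x) = (\<lambda>x. \<Sum>a\<in>W. c l a * cmonom m n (\<lambda>k j. card {p\<in>{..<N}. a (k, p) = j}) x)"
      by (intro ext sum.cong refl) (simp add: X_def W_def word_monom_eq_cmonom)
    then show "is_cpoly m n (\<lambda>x. \<Sum>a\<in>W. c l a * X a x)"
      by (simp add: is_cpoly_sum_cmonom[OF fin])
  next
    fix x
    have "(\<Prod>k<m. pairing (n k) (x k) (u k) ^ N * cnj (pairing (n k) (x k) (u k)) ^ N)
       = (\<Sum>w\<in>W. X w x * cnj (X w u)) * cnj (\<Sum>w\<in>W. X w x * cnj (X w u))" for u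
      unfolding X_def W_def prod_pairing_words[symmetric] by (simp add: prod.distrib)
    then have "(\<integral>u. hform m n F u *
       (\<Prod>k<m. pairing (n k) (x k) (u k) ^ N * cnj (pairing (n k) (x k) (u k)) ^ N) \<partial>gall m n) / of_real C
       = of_real (\<Sum>l<L. (cmod (\<Sum>a\<in>W. c l a * X a x))\<^sup>2)"
      unfolding c[symmetric] quad by simp
    from arg_cong[OF this, of Re]
    show "Re (\<integral>u. hform m n F u *
       (\<Prod>k<m. pairing (n k) (x k) (u k) ^ N * cnj (pairing (n k) (x k) (u k)) ^ N) \<partial>gall m n) / C
       = (\<Sum>l<L. (cmod (\<Sum>a\<in>W. c l a * X a x))\<^sup>2)"
      by simp
  qed
qed

subsection \<open>The corrected tensor\<close>

text \<open>The correction term cancels the Kronecker delta in \<open>block_moment\<close>: the trace of the block moments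
  is proportional to \<open>(N + d) * |x|^(2 * N)\<close>.\<close>

definition symbol_coeff :: "nat \<Rightarrow> nat \<Rightarrow> nat \<Rightarrow> nat \<Rightarrow> nat \<Rightarrow> nat \<Rightarrow> complex" where
  "symbol_coeff d N i j i' j' = of_bool (i = i' \<and> j = j') - of_bool (i = j \<and> i' = j') / of_nat (N + d)"

text \<open>The tensor product over the blocks of the maps sending \<open>A\<close> to
  \<open>A - tr(A) / (N + d)\<close> times the identity, applied to \<open>H\<close>.\<close>

definition symbol :: "nat \<Rightarrow> (nat \<Rightarrow> nat) \<Rightarrow> nat \<Rightarrow> ctensor \<Rightarrow> ctensor" where
  "symbol m n N H I J = (\<Sum>I'\<in>midx m n. \<Sum>J'\<in>midx m n.
      H I' J' * (\<Prod>k<m. symbol_coeff (n k) N (I k) (J k) (I' k) (J' k)))"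

lemma herm_symbol:
  assumes "herm_tensor m n H" shows "herm_tensor m n (symbol m n N H)"
  unfolding herm_tensor_def
proof (intro ballI)
  fix I J
  have H: "H I' J' = cnj (H J' I')" if "I' \<in> midx m n" "J' \<in> midx m n" for I' J'
    using assms that unfolding herm_tensor_def by blast
  have coeff: "cnj (symbol_coeff d N i j i' j') = symbol_coeff d N j i j' i'" for d i j i' j'
    by (auto simp: symbol_coeff_def)
  have "cnj (symbol m n N H J I) = (\<Sum>I'\<in>midx m n. \<Sum>J'\<in>midx m n.
      cnj (H I' J') * (\<Prod>k<m. symbol_coeff (n k) N (I k) (J k) (J' k) (I' k)))"
    by (simp add: symbol_def coeff)
  also have "\<dots> = (\<Sum>I'\<in>midx m n. \<Sum>J'\<in>midx m n.
      H J' I' * (\<Prod>k<m. symbol_coeff (n k) N (I k) (J k) (J' k) (I' k)))"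
    by (intro sum.cong refl arg_cong2[where f = "(*)"]) (simp add: H[symmetric])
  also have "\<dots> = symbol m n N H I J"
    unfolding symbol_def by (rule sum.swap)
  finally show "symbol m n N H I J = cnj (symbol m n N H J I)" ..
qed

text \<open>The trace corrections are of order \<open>1/N\<close>, so in the limit every block map
  becomes the identity.\<close>

lemma symbol_tendsto:
  assumes I: "I \<in> midx m n" and J: "J \<in> midx m n"
  shows "(\<lambda>N. symbol m n N H I J) \<longlonglongrightarrow> H I J"
proof -
  have coeff: "(\<lambda>N. symbol_coeff d N i j i' j') \<longlonglongrightarrow> of_bool (i = i' \<and> j = j')" for d i j i' j'
  proof -
    have "(\<lambda>N. of_bool (i = j \<and> i' = j') / (of_nat (N + d) :: complex)) \<longlonglongrightarrow> 0"
      by (rule LIMSEQ_ignore_initial_segment[OF lim_const_over_n])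
    from tendsto_diff[OF tendsto_const this] show ?thesis by (simp add: symbol_coeff_def)
  qed
  have "(\<lambda>N. symbol m n N H I J) \<longlonglongrightarrow> (\<Sum>I'\<in>midx m n. \<Sum>J'\<in>midx m n.
      H I' J' * (\<Prod>k<m. of_bool (I k = I' k \<and> J k = J' k)))"
    unfolding symbol_def by (intro tendsto_sum tendsto_mult tendsto_const tendsto_prod coeff)
  also have "(\<Sum>I'\<in>midx m n. \<Sum>J'\<in>midx m n. H I' J' * (\<Prod>k<m. of_bool (I k = I' k \<and> J k = J' k)))
     = (\<Sum>I'\<in>midx m n. \<Sum>J'\<in>midx m n. if I' = I then if J' = J then H I' J' else 0 else 0)"
  proof (intro sum.cong refl)
    fix I' J' assume IJ: "I' \<in> midx m n" "J' \<in> midx m n"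
    have ext: "A = B" if "A \<in> midx m n" "B \<in> midx m n" "\<And>k. k < m \<Longrightarrow> A k = B k" for A B
      using that unfolding midx_def by (intro PiE_ext[of A _ _ B]) auto
    show "H I' J' * (\<Prod>k<m. of_bool (I k = I' k \<and> J k = J' k))
        = (if I' = I then if J' = J then H I' J' else 0 else 0)"
    proof (cases "I' = I \<and> J' = J")
      case False
      then obtain k where "k < m" "\<not> (I k = I' k \<and> J k = J' k)"
        using ext[OF I IJ(1)] ext[OF J IJ(2)] by metis
      then have "(\<Prod>k<m. of_bool (I k = I' k \<and> J k = J' k)) = (0::complex)"
        by (intro prod_zero bexI[of _ k]) auto
      then show ?thesis using False by auto
    qed simp
  qed
  also have "\<dots> = (\<Sum>I'\<in>midx m n. if I' = I then H I' J else 0)"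
    using J finite_midx by (intro sum.cong refl) simp
  also have "\<dots> = H I J" using I finite_midx by simp
  finally show ?thesis .
qed

lemma sum_midx_prod:
  "(\<Sum>I\<in>midx m n. \<Sum>J\<in>midx m n. \<Prod>k<m. g k (I k) (J k)) = (\<Prod>k<m. \<Sum>i<n k. \<Sum>j<n k. (g k i j :: complex))"
proof -
  have "(\<Sum>J\<in>midx m n. \<Prod>k<m. g k (I k) (J k)) = (\<Prod>k<m. \<Sum>j<n k. g k (I k) j)" for I
    unfolding midx_def by (rule prod_sum_PiE[symmetric]) auto
  moreover have "(\<Sum>I\<in>midx m n. \<Prod>k<m. \<Sum>j<n k. g k (I k) j) = (\<Prod>k<m. \<Sum>i<n k. \<Sum>j<n k. g k i j)"
    unfolding midx_def by (rule prod_sum_PiE[symmetric]) auto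
  ultimately show ?thesis by simp
qed

text \<open>Exchanging the sums moves the correction from \<open>H\<close> onto the product kernel
  \<open>B\<close>, where it acts in each block separately.\<close>

lemma symbol_contract:
  "(\<Sum>I\<in>midx m n. \<Sum>J\<in>midx m n. symbol m n N H I J * (\<Prod>k<m. B k (I k) (J k)))
    = (\<Sum>I'\<in>midx m n. \<Sum>J'\<in>midx m n. H I' J' *
        (\<Prod>k<m. \<Sum>i<n k. \<Sum>j<n k. symbol_coeff (n k) N i j (I' k) (J' k) * B k i j))"
proof -
  let ?S = "midx m n"
  let ?g = "\<lambda>I J I' J'. H I' J' * (\<Prod>k<m. symbol_coeff (n k) N (I k) (J k) (I' k) (J' k) * B k (I k) (J k))"
  have "(\<Sum>I\<in>?S. \<Sum>J\<in>?S. symbol m n N H I J * (\<Prod>k<m. B k (I k) (J k)))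
     = (\<Sum>I\<in>?S. \<Sum>J\<in>?S. \<Sum>I'\<in>?S. \<Sum>J'\<in>?S. ?g I J I' J')"
    unfolding symbol_def sum_distrib_right prod.distrib by (simp only: mult.assoc)
  also have "\<dots> = (\<Sum>I\<in>?S. \<Sum>I'\<in>?S. \<Sum>J\<in>?S. \<Sum>J'\<in>?S. ?g I J I' J')"
    by (rule sum.cong[OF refl], rule sum.swap)
  also have "\<dots> = (\<Sum>I'\<in>?S. \<Sum>I\<in>?S. \<Sum>J\<in>?S. \<Sum>J'\<in>?S. ?g I J I' J')"
    by (rule sum.swap)
  also have "\<dots> = (\<Sum>I'\<in>?S. \<Sum>I\<in>?S. \<Sum>J'\<in>?S. \<Sum>J\<in>?S. ?g I J I' J')"
    by (rule sum.cong[OF refl], rule sum.cong[OF refl], rule sum.swap)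
  also have "\<dots> = (\<Sum>I'\<in>?S. \<Sum>J'\<in>?S. \<Sum>I\<in>?S. \<Sum>J\<in>?S. ?g I J I' J')"
    by (rule sum.cong[OF refl], rule sum.swap)
  also have "\<dots> = (\<Sum>I'\<in>?S. \<Sum>J'\<in>?S. H I' J' *
        (\<Prod>k<m. \<Sum>i<n k. \<Sum>j<n k. symbol_coeff (n k) N i j (I' k) (J' k) * B k i j))"
    unfolding sum_distrib_left[symmetric]
    by (subst sum_midx_prod[where g = "\<lambda>k i j. symbol_coeff (n k) N i j (I' k) (J' k) * B k i j" for I' J']) (rule refl)
  finally show ?thesis .
qed

lemma symbol_coeff_contract:
  assumes "i' < d" "j' < d"
  shows "(\<Sum>i<d. \<Sum>j<d. symbol_coeff d N i j i' j' * B i j)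
    = B i' j' - of_bool (i' = j') / of_nat (N + d) * (\<Sum>i<d. B i i)"
proof -
  have "(\<Sum>i<d. \<Sum>j<d. symbol_coeff d N i j i' j' * B i j)
    = (\<Sum>i<d. \<Sum>j<d. if i = i' then if j = j' then B i j else 0 else 0)
     - (\<Sum>i<d. \<Sum>j<d. if j = i then of_bool (i' = j') / of_nat (N + d) * B i j else 0)"
    unfolding sum_subtractf[symmetric]
    by (intro sum.cong refl) (auto simp: symbol_coeff_def left_diff_distrib)
  moreover have "(\<Sum>i<d. \<Sum>j<d. if i = i' then if j = j' then B i j else 0 else 0) = (\<Sum>i<d. if i = i' then B i j' else 0)"
    using assms by (intro sum.cong refl) auto
  ultimately show ?thesis
    using assms by (simp add: sum_distrib_left)
qed

lemma symbol_coeff_block: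
  fixes x :: "nat \<Rightarrow> complex"
  assumes "i' < d" "j' < d" "N > 0" and q: "q = (\<Sum>l<d. cnj (x l) * x l)"
  shows "(\<Sum>i<d. \<Sum>j<d. symbol_coeff d N i j i' j' *
      (fact N * (of_nat N * q ^ (N - 1) * (cnj (x i) * x j) + of_bool (i = j) * q ^ N)))
    = fact N * of_nat N * q ^ (N - 1) * (cnj (x i') * x j')"
proof -
  have "q ^ N = q ^ (N - 1) * q" using assms(3) by (cases N) auto
  \<comment> \<open>The trace: the rank-one part contributes \<open>N\<close> and the identity part
    \<open>d\<close>, which matches the denominator in \<open>symbol_coeff\<close>.\<close>
  have "(\<Sum>i<d. fact N * (of_nat N * q ^ (N - 1) * (cnj (x i) * x i) + of_bool (i = i) * q ^ N))
     = fact N * (of_nat N * q ^ (N - 1) * q + of_nat d * q ^ N)"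
    by (simp add: q sum.distrib flip: sum_distrib_left)
  also have "\<dots> = fact N * q ^ N * of_nat (N + d)"
    unfolding \<open>q ^ N = _\<close> by (simp add: algebra_simps)
  finally show ?thesis
    unfolding symbol_coeff_contract[OF assms(1,2)] using assms(3)
    by (simp add: algebra_simps del: of_nat_add)
qed

subsection \<open>From positive definiteness to sums of squares\<close>

text \<open>The corrected block moments are multiples of \<open>cnj (x i) x j\<close>, so
  contracting them with \<open>H\<close> gives back the form of \<open>H\<close> at
  \<open>x\<close>.\<close>

lemma symbol_pairing_integral:
  assumes "N > 0"
  shows "(\<integral>u. hform m n (symbol m n N H) u *
      (\<Prod>k<m. pairing (n k) (x k) (u k) ^ N * cnj (pairing (n k) (x k) (u k)) ^ N) \<partial>gall m n)
    = (fact N * of_nat N) ^ m * of_real (\<Prod>k<m. blocknorm2 n x k ^ (N - 1)) * hform m n H x"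
proof -
  define q where "q k = complex_of_real (blocknorm2 n x k)" for k
  have q: "q k = (\<Sum>l<n k. cnj (x k l) * x k l)" for k
    unfolding q_def blocknorm2_def of_real_sum complex_norm_square by (simp add: mult.commute)
  have "(\<integral>u. hform m n (symbol m n N H) u *
      (\<Prod>k<m. pairing (n k) (x k) (u k) ^ N * cnj (pairing (n k) (x k) (u k)) ^ N) \<partial>gall m n)
    = (\<Sum>I\<in>midx m n. \<Sum>J\<in>midx m n. symbol m n N H I J * (\<Prod>k<m.
       fact N * (of_nat N * q k ^ (N - 1) * (cnj (x k (I k)) * x k (J k)) + of_bool (I k = J k) * q k ^ N)))"
    unfolding q_def by (rule has_bochner_integral_integral_eq[OF hform_pairing_moment[OF assms]])
  also have "\<dots> = (\<Sum>I\<in>midx m n. \<Sum>J\<in>midx m n. H I J * (\<Prod>k<m. \<Sum>i<n k. \<Sum>j<n k.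
       symbol_coeff (n k) N i j (I k) (J k) *
       (fact N * (of_nat N * q k ^ (N - 1) * (cnj (x k i) * x k j) + of_bool (i = j) * q k ^ N))))"
    by (rule symbol_contract)
  also have "\<dots> = (\<Sum>I\<in>midx m n. \<Sum>J\<in>midx m n. H I J * (\<Prod>k<m.
       fact N * of_nat N * q k ^ (N - 1) * (cnj (x k (I k)) * x k (J k))))"
    by (intro sum.cong refl arg_cong2[where f = "(*)"] prod.cong symbol_coeff_block assms q)
       (auto dest: midxD)
  also have "\<dots> = (fact N * of_nat N) ^ m * (\<Prod>k<m. q k ^ (N - 1)) * hform m n H x"
    by (simp add: hform_def prod.distrib sum_distrib_left power_mult_distrib mult_ac)
  finally show ?thesis by (simp add: q_def)
qed

lemma C_pd_imp_Omega_C: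
  assumes "C_pd m n H"
  shows "\<exists>K. H \<in> Omega_C m n (\<lambda>_. K)"
proof -
  have herm: "herm_tensor m n H" using assms by (simp add: C_pd_def)
  obtain c where c: "c > 0" "\<And>x. Re (hform m n H x) \<ge> c * (\<Prod>k<m. blocknorm2 n x k)"
    using C_pd_lower_bound[OF assms] by blast
  have "(\<lambda>N. \<Sum>I\<in>midx m n. \<Sum>J\<in>midx m n. cmod (symbol m n N H I J - H I J)) \<longlonglongrightarrow>
      (\<Sum>I\<in>midx m n. \<Sum>J\<in>midx m n. cmod (H I J - H I J))"
    by (intro tendsto_sum tendsto_norm tendsto_diff symbol_tendsto tendsto_const)
  then have "eventually (\<lambda>N. (\<Sum>I\<in>midx m n. \<Sum>J\<in>midx m n. cmod (symbol m n N H I J - H I J)) < c) sequentially"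
    using c(1) by (intro order_tendstoD(2)) auto
  \<comment> \<open>\<open>N\<close> is large enough for the total entrywise error to stay below the
    lower bound \<open>c\<close>; \<open>N > 0\<close> is required by the moment formula and makes
    \<open>C\<close> positive.\<close>
  from eventually_happens[OF eventually_conj[OF eventually_gt_at_top[of 0] this]]
  obtain N where N: "N > 0" "(\<Sum>I\<in>midx m n. \<Sum>J\<in>midx m n. cmod (symbol m n N H I J - H I J)) < c"
    by auto
  define F where "F = symbol m n N H"
  \<comment> \<open>The form of \<open>H\<close> is at least \<open>c P\<close>, and passing to
    \<open>F\<close> changes it by at most \<open>c P\<close>.\<close>
  have F: "Re (hform m n F u) \<ge> 0" for u
  proof -
    define P where "P = (\<Prod>k<m. blocknorm2 n u k)"
    have P: "P \<ge> 0" unfolding P_def by (intro prod_nonneg) (auto simp: blocknorm2_nonneg)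
    have "cmod (hform m n F u - hform m n H u) \<le> (\<Sum>I\<in>midx m n. \<Sum>J\<in>midx m n. cmod (F I J - H I J)) * P"
      unfolding P_def by (rule hform_diff_bound)
    also have "\<dots> \<le> c * P" using N(2) P by (intro mult_right_mono) (auto simp: F_def)
    finally have "cmod (hform m n F u - hform m n H u) \<le> c * P" .
    moreover have "Re (hform m n H u) - Re (hform m n F u) \<le> cmod (hform m n F u - hform m n H u)"
      using complex_Re_le_cmod[of "- (hform m n F u - hform m n H u)"] unfolding norm_minus_cancel by simp
    moreover have "c * P \<le> Re (hform m n H u)" unfolding P_def by (rule c(2))
    ultimately show ?thesis by linarith
  qed
  \<comment> \<open>The constant from \<open>symbol_pairing_integral\<close>, one factor
    \<open>N! N\<close> per block.\<close>
  define C :: real where "C = (fact N * of_nat N) ^ m"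
  have C: "C > 0" using N(1) by (simp add: C_def)
  have average: "(\<lambda>x. (\<Prod>k<m. blocknorm2 n x k ^ (N - 1)) * Re (hform m n H x)) =
     (\<lambda>x. Re (\<integral>u. hform m n F u *
     (\<Prod>k<m. pairing (n k) (x k) (u k) ^ N * cnj (pairing (n k) (x k) (u k)) ^ N) \<partial>gall m n) / C)"
  proof
    fix x
    have eq: "(\<integral>u. hform m n F u *
      (\<Prod>k<m. pairing (n k) (x k) (u k) ^ N * cnj (pairing (n k) (x k) (u k)) ^ N) \<partial>gall m n)
      = of_real (C * (\<Prod>k<m. blocknorm2 n x k ^ (N - 1))) * hform m n H x"
      unfolding F_def symbol_pairing_integral[OF N(1)] C_def by simp
    show "(\<Prod>k<m. blocknorm2 n x k ^ (N - 1)) * Re (hform m n H x) = Re (\<integral>u. hform m n F u *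
     (\<Prod>k<m. pairing (n k) (x k) (u k) ^ N * cnj (pairing (n k) (x k) (u k)) ^ N) \<partial>gall m n) / C"
      unfolding eq using C by (simp del: of_real_mult of_real_prod)
  qed
  have "herm_sos m n (\<lambda>x. (\<Prod>k<m. blocknorm2 n x k ^ (N - 1)) * Re (hform m n H x))"
    unfolding average F_def
    by (rule herm_sos_gaussian_average[OF herm_symbol[OF herm] F[unfolded F_def] C])
  then have "H \<in> Omega_C m n (\<lambda>_. N - 1)" using herm by (simp add: Omega_C_def)
  then show ?thesis ..
qed

theorem theorem5p10:
  fixes m :: nat and n :: "nat \<Rightarrow> nat"
  shows "(\<forall>H. C_pd m n H \<longrightarrow> (\<exists>k :: nat \<Rightarrow> nat. H \<in> Omega_C m n k))
       \<and> tinterior m n (psd_cone m n) \<subseteq> (\<Union>k. Omega_C m n k)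
       \<and> (\<Union>k. Omega_C m n k) \<subseteq> psd_cone m n"
proof (intro conjI allI impI)
  show pd: "\<exists>k. H \<in> Omega_C m n k" if H: "C_pd m n H" for H
  proof -
    obtain K where "H \<in> Omega_C m n (\<lambda>_. K)" using C_pd_imp_Omega_C[OF H] ..
    then show ?thesis by (rule exI[where P = "\<lambda>k. H \<in> Omega_C m n k"])
  qed
  show "tinterior m n (psd_cone m n) \<subseteq> (\<Union>k. Omega_C m n k)"
  proof
    fix H assume "H \<in> tinterior m n (psd_cone m n)"
    from pd[OF C_pd_of_tinterior[OF this]] show "H \<in> (\<Union>k. Omega_C m n k)" by simp
  qed
  show "(\<Union>k. Omega_C m n k) \<subseteq> psd_cone m n"
    by (intro UN_least Omega_C_subset_psd_cone)
qed

end
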